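(* Consider the diluted mixed $p$-spin model with parameters $\Delta\ge2$ and $(\alpha_p)_{2\le p\le\Delta}$, $\alpha_p>0$, and let $\lambda=\sum_{2\le p\le\Delta}p(p-1)\alpha_p$. Let $t\ge0$ and $\beta\in[0,\infty]$. Assume $\lambda>1$. For both the continuous and the discrete perturbation, there exists a constant $C>0$ depending only on $(\alpha_p)_{2\le p\le\Delta}$ such that $$\mathbb E\langle R(\sigma,\tau)^2\rangle_t\le\frac{C}{N^{t/(t+2\log\lambda)}}.$$
   Context: Random hypergraph: fix an integer $\Delta\ge2$ and $\alpha_p>0$ for $2\le p\le\Delta$. For each $2\le p\le\Delta$, each $p$-element subset of $[N]$ is selected independently with probability $\alpha_pN/\binom Np$ ($N$ is assumed such that $N\ge\Delta$ and these numbers are in $[0,1]$); $E_p$ is the set of selected subsets, and $E=\bigcup_{2\le p\le\Delta}E_p$. $V(e)$ denotes the vertex set of $e\in E$. Model: independently of $E$, $(J_e)$ are i.i.d. standard Gaussians; for each $p$, $\rho_p:\mathbb R\to\mathbb R$ is an odd measurable function. With $\sigma_e=\prod_{i\in V(e)}\sigma_i$, the Hamiltonian is $H_J(\sigma)=\sum_{2\le p\le\Delta}\sum_{e\in E_p}\rho_p(J_e)\sigma_e$ for $\sigma\in\{\pm1\}^N$. For $\beta<\infty$ the Gibbs measure is $G_{J,\beta}(\sigma)\propto e^{\beta H_J(\sigma)}$; for $\beta=\infty$ it is the uniform measure on the set of maximizers of $H_J$. Perturbations (the hypergraph is not perturbed): let $J'$ be an independent copy of $J$. Continuous: $J_e(t)=e^{-t}J_e+\sqrt{1-e^{-2t}}\,J'_e$.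 Discrete: $J_e(t)=B_eJ_e+(1-B_e)J'_e$ with $B_e$ i.i.d. Bernoulli, $\mathbb P(B_e=1)=e^{-t}$, independent of everything else. Overlap: $R(\sigma,\tau)=\frac1N\sum_{i=1}^N\sigma_i\tau_i$; $\langle\cdot\rangle_t$ is the expectation over $(\sigma,\tau)\sim G_{J,\beta}\otimes G_{J(t),\beta}$ (same hypergraph for both), and $\mathbb E$ is the expectation over the disorder and the random hypergraph. *)

theory Defs
  imports "HOL-Probability.Probability"
begin

subsection \<open>Random hypergraph and disorder\<close>

text \<open>A potential hyperedge is identified with its vertex set, a subset of \<open>{1..N}\<close>.\<close>

definition potential_edges :: "nat \<Rightarrow> nat \<Rightarrow> nat set set" where
  "potential_edges \<Delta> N = {e. e \<subseteq> {1..N} \<and> 2 \<le> card e \<and> card e \<le> \<Delta>}"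

definition edge_prob :: "(nat \<Rightarrow> real) \<Rightarrow> nat \<Rightarrow> nat \<Rightarrow> real" where
  "edge_prob \<alpha> N p = \<alpha> p * real N / real (N choose p)"

definition admissible_size :: "nat \<Rightarrow> (nat \<Rightarrow> real) \<Rightarrow> nat \<Rightarrow> bool" where
  "admissible_size \<Delta> \<alpha> N \<longleftrightarrow> \<Delta> \<le> N \<and> (\<forall>p\<in>{2..\<Delta>}. edge_prob \<alpha> N p \<in> {0..1})"

definition selection_law :: "nat \<Rightarrow> (nat \<Rightarrow> real) \<Rightarrow> nat \<Rightarrow> (nat set \<Rightarrow> bool) measure" where
  "selection_law \<Delta> \<alpha> N =
     (\<Pi>\<^sub>M e\<in>potential_edges \<Delta> N. measure_pmf (bernoulli_pmf (edge_prob \<alpha> N (card e))))"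

definition edges :: "nat \<Rightarrow> (nat set \<Rightarrow> bool) \<Rightarrow> nat \<Rightarrow> nat set set" where
  "edges N S p = {e. e \<subseteq> {1..N} \<and> card e = p \<and> S e}"

text \<open>Couplings are attached to all potential hyperedges; since they are independent of the
  hypergraph, this does not change the law of the couplings on the selected ones.\<close>

definition gaussian_law :: "nat \<Rightarrow> nat \<Rightarrow> (nat set \<Rightarrow> real) measure" where
  "gaussian_law \<Delta> N = (\<Pi>\<^sub>M e\<in>potential_edges \<Delta> N. density lborel std_normal_density)"

definition resampling_law :: "nat \<Rightarrow> nat \<Rightarrow> real \<Rightarrow> (nat set \<Rightarrow> bool) measure" where
  "resampling_law \<Delta> N t =
     (\<Pi>\<^sub>M e\<in>potential_edges \<Delta> N. measure_pmf (bernoulli_pmf (exp (- t))))"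

text \<open>Joint law of the selection indicators, \<open>J\<close>, \<open>J'\<close> and \<open>B\<close>.
  The last component is only used by the discrete perturbation.\<close>

definition disorder_law :: "nat \<Rightarrow> (nat \<Rightarrow> real) \<Rightarrow> nat \<Rightarrow> real \<Rightarrow>
    ((nat set \<Rightarrow> bool) \<times> (nat set \<Rightarrow> real) \<times> (nat set \<Rightarrow> real) \<times> (nat set \<Rightarrow> bool)) measure" where
  "disorder_law \<Delta> \<alpha> N t =
     selection_law \<Delta> \<alpha> N \<Otimes>\<^sub>M (gaussian_law \<Delta> N \<Otimes>\<^sub>M (gaussian_law \<Delta> N \<Otimes>\<^sub>M resampling_law \<Delta> N t))"

datatype perturbation = Continuous | Discrete

fun perturbed :: "perturbation \<Rightarrow> real \<Rightarrow> (nat set \<Rightarrow> real) \<Rightarrow> (nat set \<Rightarrow> real) \<Rightarrow>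
    (nat set \<Rightarrow> bool) \<Rightarrow> nat set \<Rightarrow> real" where
  "perturbed Continuous t J J' B e = exp (- t) * J e + sqrt (1 - exp (- 2 * t)) * J' e"
| "perturbed Discrete t J J' B e = of_bool (B e) * J e + (1 - of_bool (B e)) * J' e"


subsection \<open>The diluted mixed p-spin model\<close>

definition configs :: "nat \<Rightarrow> (nat \<Rightarrow> real) set" where
  "configs N = {1..N} \<rightarrow>\<^sub>E {-1, 1}"

definition hamiltonian :: "nat \<Rightarrow> (nat \<Rightarrow> real \<Rightarrow> real) \<Rightarrow> nat \<Rightarrow> (nat set \<Rightarrow> bool) \<Rightarrow>
    (nat set \<Rightarrow> real) \<Rightarrow> (nat \<Rightarrow> real) \<Rightarrow> real" where
  "hamiltonian \<Delta> \<rho> N S J \<sigma> = (\<Sum>p = 2..\<Delta>. \<Sum>e\<in>edges N S p. \<rho> p (J e) * (\<Prod>i\<in>e. \<sigma> i))"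

definition gibbs :: "nat \<Rightarrow> ennreal \<Rightarrow> ((nat \<Rightarrow> real) \<Rightarrow> real) \<Rightarrow> (nat \<Rightarrow> real) pmf" where
  "gibbs N \<beta> H =
     (if \<beta> = \<infinity> then pmf_of_set {\<sigma>. is_arg_max H (\<lambda>\<sigma>. \<sigma> \<in> configs N) \<sigma>}
      else embed_pmf (\<lambda>\<sigma>. if \<sigma> \<in> configs N
             then exp (enn2real \<beta> * H \<sigma>) / (\<Sum>\<tau>\<in>configs N. exp (enn2real \<beta> * H \<tau>))
             else 0))"

text \<open>The arguments of \<open>embed_pmf\<close> and \<open>pmf_of_set\<close> above are legitimate, so \<open>gibbs\<close> is not a
  default value.\<close>

lemma finite_configs: "finite (configs N)"
  by (simp add: configs_def finite_PiE)

lemma configs_nonempty: "configs N \<noteq> {}"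
  by (simp add: configs_def PiE_eq_empty_iff)

lemma pmf_gibbs_finite:
  assumes "\<beta> \<noteq> \<infinity>"
  shows "pmf (gibbs N \<beta> H) \<sigma> =
    (if \<sigma> \<in> configs N
     then exp (enn2real \<beta> * H \<sigma>) / (\<Sum>\<tau>\<in>configs N. exp (enn2real \<beta> * H \<tau>)) else 0)"
proof -
  define Z where "Z = (\<Sum>\<tau>\<in>configs N. exp (enn2real \<beta> * H \<tau>))"
  have Z: "Z > 0"
    unfolding Z_def by (intro sum_pos finite_configs configs_nonempty) auto
  let ?f = "\<lambda>\<sigma>. if \<sigma> \<in> configs N then exp (enn2real \<beta> * H \<sigma>) / Z else 0"
  have "(\<integral>\<^sup>+ \<sigma>. ennreal (?f \<sigma>) \<partial>count_space UNIV) = (\<Sum>\<sigma>\<in>configs N. ennreal (?f \<sigma>))"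
    by (intro nn_integral_count_space' finite_configs) auto
  also have "\<dots> = ennreal (\<Sum>\<sigma>\<in>configs N. ?f \<sigma>)"
    using Z by (intro sum_ennreal) auto
  also have "(\<Sum>\<sigma>\<in>configs N. ?f \<sigma>) = (\<Sum>\<sigma>\<in>configs N. exp (enn2real \<beta> * H \<sigma>)) / Z"
    by (simp add: sum_divide_distrib)
  also have "\<dots> = 1"
    using Z by (simp add: Z_def)
  finally have "pmf (embed_pmf ?f) \<sigma> = ?f \<sigma>"
    using Z by (intro pmf_embed_pmf) auto
  moreover have "gibbs N \<beta> H = embed_pmf ?f"
    unfolding gibbs_def Z_def using assms by simp
  ultimately show ?thesis
    unfolding Z_def by simp
qed

lemma set_pmf_gibbs_infinite:
  "set_pmf (gibbs N \<infinity> H) = {\<sigma>. is_arg_max H (\<lambda>\<sigma>. \<sigma> \<in> configs N) \<sigma>}" (is "_ = ?A")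
proof -
  have "?A \<subseteq> configs N"
    by (auto simp: is_arg_max_def)
  then have fin: "finite ?A"
    using finite_configs finite_subset by blast
  have "Max (H ` configs N) \<in> H ` configs N"
    using finite_configs configs_nonempty by (intro Max_in) auto
  then obtain \<sigma> where "\<sigma> \<in> configs N" "H \<sigma> = Max (H ` configs N)"
    by auto
  then have "\<sigma> \<in> ?A"
    by (auto simp: is_arg_max_linorder finite_configs)
  then have "?A \<noteq> {}"
    by blast
  with fin show ?thesis
    by (simp add: gibbs_def)
qed

definition overlap :: "nat \<Rightarrow> (nat \<Rightarrow> real) \<Rightarrow> (nat \<Rightarrow> real) \<Rightarrow> real" where
  "overlap N \<sigma> \<tau> = 1 / real N * (\<Sum>i = 1..N. \<sigma> i * \<tau> i)"

definition gibbs_average :: "nat \<Rightarrow> (nat \<Rightarrow> real \<Rightarrow> real) \<Rightarrow> nat \<Rightarrow> ennreal \<Rightarrow> (nat set \<Rightarrow> bool) \<Rightarrow>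
    (nat set \<Rightarrow> real) \<Rightarrow> (nat set \<Rightarrow> real) \<Rightarrow> ((nat \<Rightarrow> real) \<Rightarrow> (nat \<Rightarrow> real) \<Rightarrow> real) \<Rightarrow> real" where
  "gibbs_average \<Delta> \<rho> N \<beta> S J Jt f =
     measure_pmf.expectation
       (pair_pmf (gibbs N \<beta> (hamiltonian \<Delta> \<rho> N S J)) (gibbs N \<beta> (hamiltonian \<Delta> \<rho> N S Jt)))
       (\<lambda>(\<sigma>, \<tau>). f \<sigma> \<tau>)"

definition mean_square_overlap :: "perturbation \<Rightarrow> nat \<Rightarrow> (nat \<Rightarrow> real) \<Rightarrow> (nat \<Rightarrow> real \<Rightarrow> real) \<Rightarrow>
    nat \<Rightarrow> ennreal \<Rightarrow> real \<Rightarrow> real" where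
  "mean_square_overlap \<pi> \<Delta> \<alpha> \<rho> N \<beta> t =
     (\<integral>(S, J, J', B). gibbs_average \<Delta> \<rho> N \<beta> S J (perturbed \<pi> t J J' B) (\<lambda>\<sigma> \<tau>. (overlap N \<sigma> \<tau>)\<^sup>2)
        \<partial>disorder_law \<Delta> \<alpha> N t)"

end

(*
  Expanding the square reduces the claim to the correlations phi_ij(J) = <sigma_i sigma_j>_J:
  the mean square overlap is the average over i, j of E[phi_ij(J) phi_ij(J(t))].

  Decompose phi_ij according to its parity in each coupling. Flipping the spin at a vertex v is the
  same as flipping all couplings on edges through v, so only those parity classes A survive for which
  A consists of selected edges and exactly the vertices i and j lie in an odd number of edges of A.
  Perturbing a coupling contracts functions that are odd in it by the factor exp(-t), so
  E[phi_ij(J) phi_ij(J(t))] <= exp(-t(K+1)) as soon as there is no such A with at most K edges.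

  A set A with at most K edges and these parities contains a walk from i with at most K distinct edges
  that ends at i, at j or on one of its own earlier edges. The expected number of walks with m edges
  is at most lam^m, and closing up costs a further factor O(m/N), so such an A exists with probability
  O(K lam^K / N) = O(lam^(2K) / N). Taking K close to ln N / (t + 2 ln lam) balances the two errors.
*)
theory Submission
  imports Defs
begin

subsection \<open>Products of product measures\<close>

text \<open>A correlation is known only as a bounded measurable function with sign symmetries.
  Parity classes are therefore used in place of Hermite polynomials: they make sense pointwise, the
  gauge symmetry acts on them by signs, and they serve both perturbations. The analytic core
  concerns one coupling. Under resampling the contraction of odd functions is immediate. For the
  Gaussian step the usual proof expands in Hermite polynomials; here a Schur test with the
  eigenfunction |x| replaces the expansion. To pass to many couplings, the estimate for one coupling
  must be applied after all others have been integrated out. What is left is then no longer a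
  product f(x) g(y) but a function h(x, y), of which only h^2 <= a(x) b(y) is known. This is why the
  locale \<open>noisy_pair\<close> asks for the contraction in that generality. The hypergraph is
  never conditioned on a good event. The number of closing walks itself is the error term: if it is
  at least 1, it exceeds the trivial bound 1 on a correlation product, and if it is below 1, no
  short parity class survives. Only its expectation is needed, which is linear.\<close>

lemma measurable_PiM_insert_update [measurable (raw)]:
  assumes "f \<in> measurable N (PiM I M)" "h \<in> measurable N (M i)"
  shows "(\<lambda>x. (f x)(i := h x)) \<in> measurable N (PiM (insert i I) M)"
  using assms by (intro measurable_fun_upd[where J = I]) auto

lemma measurable_zip_PiM:
  assumes [measurable]: "f \<in> measurable N (PiM I M)" "g \<in> measurable N (PiM I L)"
  shows "(\<lambda>x. \<lambda>i\<in>I. (f x i, g x i)) \<in> measurable N (\<Pi>\<^sub>M i\<in>I. M i \<Otimes>\<^sub>M L i)"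
  by (intro measurable_restrict measurable_Pair
      measurable_compose[OF assms(1) measurable_component_singleton]
      measurable_compose[OF assms(2) measurable_component_singleton])

text \<open>The disorder is given as independent fields over all edges, whereas an induction over
  edges needs one independent family of tuples. This is the rearrangement for two fields, for
  nonnegative integrals because Fubini then asks for measurability only.\<close>

lemma nn_integral_PiM_zip:
  assumes "finite I" and M: "\<And>i. prob_space (M i)" and L: "\<And>i. prob_space (L i)"
    and "F \<in> borel_measurable (\<Pi>\<^sub>M i\<in>I. M i \<Otimes>\<^sub>M L i)"
  shows "(\<integral>\<^sup>+ w. F w \<partial>(\<Pi>\<^sub>M i\<in>I. M i \<Otimes>\<^sub>M L i)) =
    (\<integral>\<^sup>+x. (\<integral>\<^sup>+y. F (\<lambda>i\<in>I. (x i, y i)) \<partial>PiM I L) \<partial>PiM I M)"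
  using assms(1,4)
proof (induction I arbitrary: F rule: finite_induct)
  case empty
  then show ?case
    by (simp add: PiM_empty nn_integral_count_space_finite)
next
  case (insert i I)
  interpret M: prob_space "M j" for j by (rule M)
  interpret L: prob_space "L j" for j by (rule L)
  interpret pairML: pair_prob_space "M j" "L k" for j k by unfold_locales
  interpret PM: product_prob_space M UNIV ..
  interpret PL: product_prob_space L UNIV ..
  interpret PP: product_prob_space "\<lambda>i. M i \<Otimes>\<^sub>M L i" UNIV ..
  interpret PMI: prob_space "PiM I M" by (rule prob_space_PiM) (rule M)
  interpret PLI: prob_space "PiM I L" by (rule prob_space_PiM) (rule L)
  interpret PLI': prob_space "PiM (insert i I) L" by (rule prob_space_PiM) (rule L)
  note [measurable] = insert.prems measurable_zip_PiM
  have upd: "(\<lambda>j\<in>insert i I. ((x(i := a)) j, (y(i := b)) j)) = (\<lambda>j\<in>I. (x j, y j))(i := (a, b))"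
    for x y a b using insert.hyps by (auto simp: fun_eq_iff)
  have "(\<integral>\<^sup>+ w. F w \<partial>(\<Pi>\<^sub>M i\<in>insert i I. M i \<Otimes>\<^sub>M L i)) =
    (\<integral>\<^sup>+ w. (\<integral>\<^sup>+p. F (w(i := p)) \<partial>(M i \<Otimes>\<^sub>M L i)) \<partial>(\<Pi>\<^sub>M i\<in>I. M i \<Otimes>\<^sub>M L i))"
    using insert by (intro PP.product_nn_integral_insert) auto
  also have "\<dots> = (\<integral>\<^sup>+x. (\<integral>\<^sup>+y. (\<integral>\<^sup>+p. F ((\<lambda>j\<in>I. (x j, y j))(i := p)) \<partial>(M i \<Otimes>\<^sub>M L i)) \<partial>PiM I L) \<partial>PiM I M)"
    by (rule insert.IH) measurable
  also have "\<dots> = (\<integral>\<^sup>+x. (\<integral>\<^sup>+y. (\<integral>\<^sup>+a. (\<integral>\<^sup>+b. F ((\<lambda>j\<in>I. (x j, y j))(i := (a, b))) \<partial>L i) \<partial>M i) \<partial>PiM I L) \<partial>PiM I M)"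
    by (intro nn_integral_cong L.nn_integral_fst[symmetric]) measurable
  \<comment> \<open>Exchanging a with the remaining y lets y and b merge into one point of the
    larger product.\<close>
  also have "\<dots> = (\<integral>\<^sup>+x. (\<integral>\<^sup>+a. (\<integral>\<^sup>+y. (\<integral>\<^sup>+b. F ((\<lambda>j\<in>I. (x j, y j))(i := (a, b))) \<partial>L i) \<partial>PiM I L) \<partial>M i) \<partial>PiM I M)"
  proof (intro nn_integral_cong pair_sigma_finite.Fubini')
    show "pair_sigma_finite (M i) (PiM I L)" ..
    fix x assume [measurable]: "x \<in> space (PiM I M)"
    show "(\<lambda>(a, y). \<integral>\<^sup>+b. F ((\<lambda>j\<in>I. (x j, y j))(i := (a, b))) \<partial>L i) \<in> borel_measurable (M i \<Otimes>\<^sub>M PiM I L)"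
      by measurable
  qed
  also have "\<dots> = (\<integral>\<^sup>+x. (\<integral>\<^sup>+a. (\<integral>\<^sup>+y. F (\<lambda>j\<in>insert i I. ((x(i := a)) j, y j)) \<partial>PiM (insert i I) L) \<partial>M i) \<partial>PiM I M)"
  proof (intro nn_integral_cong)
    fix x a assume [measurable]: "x \<in> space (PiM I M)" "a \<in> space (M i)"
    show "(\<integral>\<^sup>+y. (\<integral>\<^sup>+b. F ((\<lambda>j\<in>I. (x j, y j))(i := (a, b))) \<partial>L i) \<partial>PiM I L) =
      (\<integral>\<^sup>+y. F (\<lambda>j\<in>insert i I. ((x(i := a)) j, y j)) \<partial>PiM (insert i I) L)"
      by (subst PL.product_nn_integral_insert[OF insert.hyps], measurable) (simp only: upd)
  qed
  also have "\<dots> = (\<integral>\<^sup>+x. (\<integral>\<^sup>+y. F (\<lambda>j\<in>insert i I. (x j, y j)) \<partial>PiM (insert i I) L) \<partial>PiM (insert i I) M)"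
  proof (rule PM.product_nn_integral_insert[OF insert.hyps, symmetric])
    have "(\<lambda>(x, y). F (\<lambda>j\<in>insert i I. (x j, y j))) \<in>
      borel_measurable (PiM (insert i I) M \<Otimes>\<^sub>M PiM (insert i I) L)"
      unfolding case_prod_beta
      by (rule measurable_compose[OF measurable_zip_PiM insert.prems]) measurable
    then show "(\<lambda>x. \<integral>\<^sup>+y. F (\<lambda>j\<in>insert i I. (x j, y j)) \<partial>PiM (insert i I) L) \<in>
      borel_measurable (PiM (insert i I) M)"
      by (rule PLI'.borel_measurable_nn_integral)
  qed
  finally show ?case .
qed

lemma measurable_zip3_PiM [measurable]:
  "(\<lambda>(x, y, z). \<lambda>i\<in>I. (x i, y i, z i)) \<in>
    measurable (PiM I M \<Otimes>\<^sub>M (PiM I L \<Otimes>\<^sub>M PiM I K)) (\<Pi>\<^sub>M i\<in>I. M i \<Otimes>\<^sub>M (L i \<Otimes>\<^sub>M K i))"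
    (is "?z \<in> measurable ?P ?Q")
proof -
  have "(\<lambda>p. \<lambda>i\<in>I. (fst p i, (\<lambda>i\<in>I. (fst (snd p) i, snd (snd p) i)) i)) \<in> measurable ?P ?Q"
    by (intro measurable_zip_PiM) measurable
  moreover have "(\<lambda>p. \<lambda>i\<in>I. (fst p i, (\<lambda>i\<in>I. (fst (snd p) i, snd (snd p) i)) i)) = ?z"
    by (auto simp: fun_eq_iff)
  ultimately show ?thesis by (simp only:)
qed

text \<open>Zips twice, the last two fields first. For \<open>J\<close>, \<open>J'\<close> and
  \<open>B\<close> it yields independent triples indexed by the edges.\<close>

lemma distr_zip_PiM:
  assumes I: "finite I" and M: "\<And>i. prob_space (M i)" and L: "\<And>i. prob_space (L i)"
    and K: "\<And>i. prob_space (K i)"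
  shows "distr (PiM I M \<Otimes>\<^sub>M (PiM I L \<Otimes>\<^sub>M PiM I K)) (\<Pi>\<^sub>M i\<in>I. M i \<Otimes>\<^sub>M (L i \<Otimes>\<^sub>M K i))
    (\<lambda>(x, y, z). \<lambda>i\<in>I. (x i, y i, z i)) = (\<Pi>\<^sub>M i\<in>I. M i \<Otimes>\<^sub>M (L i \<Otimes>\<^sub>M K i))" (is "distr ?P ?Q ?z = ?Q")
proof (rule measure_eqI)
  interpret PL: prob_space "PiM I L" by (rule prob_space_PiM) (rule L)
  interpret PK: prob_space "PiM I K" by (rule prob_space_PiM) (rule K)
  interpret PLK: pair_prob_space "PiM I L" "PiM I K" ..
  have LK: "prob_space (L i \<Otimes>\<^sub>M K i)" for i
    using L K by (intro prob_space_pair)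
  fix A assume "A \<in> sets (distr ?P ?Q ?z)"
  then have [measurable]: "A \<in> sets ?Q" by simp
  have "emeasure (distr ?P ?Q ?z) A = (\<integral>\<^sup>+p. indicator A (?z p) \<partial>?P)"
    by (simp add: nn_integral_distr flip: nn_integral_indicator)
  also have "\<dots> = (\<integral>\<^sup>+x. (\<integral>\<^sup>+y. (\<integral>\<^sup>+z. indicator A (?z (x, y, z)) \<partial>PiM I K) \<partial>PiM I L) \<partial>PiM I M)"
    by (subst PLK.nn_integral_fst[symmetric], measurable)
      (intro nn_integral_cong PK.nn_integral_fst[symmetric], measurable)
  also have "\<dots> = (\<integral>\<^sup>+x. (\<integral>\<^sup>+v. indicator A (\<lambda>i\<in>I. (x i, v i)) \<partial>(\<Pi>\<^sub>M i\<in>I. L i \<Otimes>\<^sub>M K i)) \<partial>PiM I M)"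
  proof (intro nn_integral_cong)
    fix x assume [measurable]: "x \<in> space (PiM I M)"
    note measurable_zip_PiM[measurable]
    have eq: "(\<lambda>i\<in>I. (x i, restrict (\<lambda>i. (y i, z i)) I i)) = (\<lambda>i\<in>I. (x i, y i, z i))" for y z
      by (auto simp: fun_eq_iff)
    show "(\<integral>\<^sup>+y. (\<integral>\<^sup>+z. indicator A (?z (x, y, z)) \<partial>PiM I K) \<partial>PiM I L) =
      (\<integral>\<^sup>+v. indicator A (\<lambda>i\<in>I. (x i, v i)) \<partial>(\<Pi>\<^sub>M i\<in>I. L i \<Otimes>\<^sub>M K i))"
      by (subst nn_integral_PiM_zip[OF I L K]) (measurable, simp only: eq prod.case)
  qed
  also have "\<dots> = (\<integral>\<^sup>+ w. indicator A w \<partial>?Q)"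
    by (subst nn_integral_PiM_zip[OF I M LK]) auto
  also have "\<dots> = emeasure ?Q A" by simp
  finally show "emeasure (distr ?P ?Q ?z) A = emeasure ?Q A" .
qed simp

subsection \<open>Parity decomposition and noise\<close>

definition flip :: "'i set \<Rightarrow> ('i \<Rightarrow> real) \<Rightarrow> 'i \<Rightarrow> real" where
  "flip U x i = (if i \<in> U then - x i else x i)"

text \<open>For finite \<open>I\<close> this is 2^(card I) times the component of \<open>f\<close>
  that is odd in each coordinate of \<open>A\<close> and even in each other coordinate of
  \<open>I\<close>. It involves no measure, so its vanishing follows from sign symmetries
  alone.\<close>

definition walsh :: "'i set \<Rightarrow> 'i set \<Rightarrow> (('i \<Rightarrow> real) \<Rightarrow> real) \<Rightarrow> ('i \<Rightarrow> real) \<Rightarrow> real" where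
  "walsh I A f x = (\<Sum>U\<in>Pow I. (- 1) ^ card (U \<inter> A) * f (flip U x))"

text \<open>Counterpart of having no Fourier terms of degree below \<open>k\<close>. The vanishing
  is required at every point and not almost everywhere, so it survives when a coordinate is
  fixed.\<close>

definition high_degree :: "nat \<Rightarrow> 'i set \<Rightarrow> (('i \<Rightarrow> real) \<Rightarrow> real) \<Rightarrow> bool" where
  "high_degree k I f \<longleftrightarrow> (\<forall>A\<subseteq>I. card A < k \<longrightarrow> (\<forall>x. walsh I A f x = 0))"

text \<open>The value of the coordinate \<open>i\<close> is a separate argument \<open>u\<close>:
  for fixed \<open>u\<close> the part is a function of the remaining coordinates, to which an
  induction hypothesis applies. The same holds for \<open>odd_part\<close>.\<close>

definition even_part :: "'i \<Rightarrow> (('i \<Rightarrow> real) \<Rightarrow> real) \<Rightarrow> real \<Rightarrow> ('i \<Rightarrow> real) \<Rightarrow> real" where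
  "even_part i f u x = (f (x(i := u)) + f (x(i := - u))) / 2"

definition odd_part :: "'i \<Rightarrow> (('i \<Rightarrow> real) \<Rightarrow> real) \<Rightarrow> real \<Rightarrow> ('i \<Rightarrow> real) \<Rightarrow> real" where
  "odd_part i f u x = (f (x(i := u)) - f (x(i := - u))) / 2"

lemma flip_empty [simp]: "flip {} x = x"
  by (simp add: flip_def fun_eq_iff)

lemma flip_upd:
  assumes "i \<notin> U"
  shows "(flip U x)(i := u) = flip U (x(i := u))"
    and "flip U (x(i := - u)) = flip (insert i U) (x(i := u))"
  using assms by (auto simp: flip_def fun_eq_iff)

text \<open>The subsets of \<open>insert i I\<close> come in pairs U and \<open>insert i U\<close>,
  whose terms evaluate \<open>f\<close> at u and at -u. The two signs agree if \<open>i\<close> is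
  outside the class and differ if it is inside, which produces the even and the odd part.\<close>

lemma walsh_insert:
  assumes "finite I" "i \<notin> I" "A \<subseteq> I"
  shows "walsh I A (even_part i f u) x = walsh (insert i I) A f (x(i := u)) / 2"
    and "walsh I A (odd_part i f u) x = walsh (insert i I) (insert i A) f (x(i := u)) / 2"
proof -
  have inj: "inj_on (insert i) (Pow I)"
    using assms(2) by (auto simp: inj_on_def)
  have disj: "Pow I \<inter> insert i ` Pow I = {}"
    using assms(2) by auto
  have split: "(\<Sum>U\<in>Pow (insert i I). g U) = (\<Sum>U\<in>Pow I. g U + g (insert i U))" for g :: "'a set \<Rightarrow> real"
    using assms(1) disj
    by (simp add: Pow_insert sum.union_disjoint sum.reindex[OF inj] sum.distrib)
  have U: "finite U" "i \<notin> U" if "U \<in> Pow I" for U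
    using that assms finite_subset by auto
  have *: "card (insert i U \<inter> A) = card (U \<inter> A)" "card (U \<inter> insert i A) = card (U \<inter> A)"
    "card (insert i U \<inter> insert i A) = Suc (card (U \<inter> A))" if "U \<in> Pow I" for U
  proof -
    show "card (insert i U \<inter> A) = card (U \<inter> A)" "card (U \<inter> insert i A) = card (U \<inter> A)"
      using U[OF that] assms by (auto intro!: arg_cong[where f = card])
    have "insert i U \<inter> insert i A = insert i (U \<inter> A)" by auto
    then show "card (insert i U \<inter> insert i A) = Suc (card (U \<inter> A))"
      using U[OF that] by simp
  qed
  show "walsh I A (even_part i f u) x = walsh (insert i I) A f (x(i := u)) / 2"
    unfolding walsh_def split even_part_def sum_divide_distrib
    by (intro sum.cong refl) (simp add: flip_upd U *, simp add: field_simps)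
  show "walsh I A (odd_part i f u) x = walsh (insert i I) (insert i A) f (x(i := u)) / 2"
    unfolding walsh_def split odd_part_def sum_divide_distrib
    by (intro sum.cong refl) (simp add: flip_upd U *, simp add: field_simps)
qed

lemma high_degree_even_part:
  assumes "finite I" "i \<notin> I" "high_degree k (insert i I) f"
  shows "high_degree k I (even_part i f u)"
  using assms unfolding high_degree_def by (auto simp: walsh_insert)

lemma high_degree_odd_part:
  assumes "finite I" "i \<notin> I" "high_degree (Suc k) (insert i I) f"
  shows "high_degree k I (odd_part i f u)"
  unfolding high_degree_def
proof (intro allI impI)
  fix A x assume A: "A \<subseteq> I" "card A < k"
  then have "insert i A \<subseteq> insert i I" "card (insert i A) < Suc k"
    using assms(1,2) finite_subset[OF A(1)] by (auto simp: card_insert_if)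
  then have "walsh (insert i I) (insert i A) f (x(i := u)) = 0"
    using assms(3) by (auto simp: high_degree_def)
  then show "walsh I A (odd_part i f u) x = 0"
    using assms A by (simp add: walsh_insert)
qed

lemma high_degree_mult: "high_degree k I f \<Longrightarrow> high_degree k I (\<lambda>x. c * f x)"
proof -
  have "walsh I A (\<lambda>x. c * f x) x = c * walsh I A f x" for A x
    by (simp add: walsh_def sum_distrib_left mult_ac)
  then show "high_degree k I f \<Longrightarrow> high_degree k I (\<lambda>x. c * f x)"
    by (simp add: high_degree_def)
qed

lemma bounded_range_comp: "bounded (range f) \<Longrightarrow> bounded (range (\<lambda>x. f (h x)))"
  by (rule bounded_subset) auto

lemma bounded_range_mult:
  fixes f g :: "'a \<Rightarrow> real"
  assumes "bounded (range f)" "bounded (range g)"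
  shows "bounded (range (\<lambda>x. f x * g x))"
proof -
  obtain B C where "\<And>x. \<bar>f x\<bar> \<le> B" "\<And>x. \<bar>g x\<bar> \<le> C"
    using assms by (auto simp: bounded_iff)
  then have "\<bar>f x * g x\<bar> \<le> B * C" for x
    unfolding abs_mult by (intro mult_mono) (auto intro: order_trans[OF abs_ge_zero])
  then show ?thesis by (auto simp: bounded_iff)
qed

lemma (in prob_space) integrable_bounded_range:
  fixes f :: "'a \<Rightarrow> real"
  assumes "f \<in> borel_measurable M" "bounded (range f)"
  shows "integrable M f"
proof -
  obtain B where "\<And>x. \<bar>f x\<bar> \<le> B"
    using assms by (auto simp: bounded_iff)
  then show ?thesis
    using assms(1) by (intro integrable_const_bound[where B = B]) auto
qed

lemma (in prob_space) bounded_range_integral: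
  fixes F :: "'b \<Rightarrow> 'a \<Rightarrow> real"
  assumes "bounded (range (\<lambda>p. F (fst p) (snd p)))"
  shows "bounded (range (\<lambda>x. \<integral>w. F x w \<partial>M))"
proof -
  obtain B where B: "\<And>x w. \<bar>F x w\<bar> \<le> B"
    using assms by (auto simp: bounded_iff)
  have "\<bar>\<integral>w. F x w \<partial>M\<bar> \<le> B" for x
  proof (cases "integrable M (F x)")
    case True
    then have "\<bar>\<integral>w. F x w \<partial>M\<bar> \<le> (\<integral>w. B \<partial>M)"
      using B by (intro order_trans[OF integral_abs_bound] integral_mono) auto
    then show ?thesis by (simp add: prob_space)
  next
    \<comment> \<open>The default value 0 of the integral obeys the bound as well.\<close>
    case False
    then show ?thesis
      using order_trans[OF abs_ge_zero B] by (simp add: not_integrable_integral_eq)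
  qed
  then show ?thesis by (auto simp: bounded_iff)
qed

text \<open>The bound on \<open>h\<close> in the last assumption says \<open>h (x, y)\<^sup>2 \<le> a x * b y\<close>, in the
  linearised form that integrates well.\<close>

locale noisy_pair = prob_space \<kappa> for \<kappa> :: "'w measure" +
  fixes X Y :: "'w \<Rightarrow> real" and q :: real
  assumes X [measurable]: "X \<in> borel_measurable \<kappa>" and Y [measurable]: "Y \<in> borel_measurable \<kappa>"
    and q_nonneg: "0 \<le> q"
    and joint_flip: "\<And>h :: real \<times> real \<Rightarrow> real. h \<in> borel_measurable (borel \<Otimes>\<^sub>M borel) \<Longrightarrow> bounded (range h) \<Longrightarrow>
      (\<integral>w. h (- X w, - Y w) \<partial>\<kappa>) = (\<integral>w. h (X w, Y w) \<partial>\<kappa>)"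
    and odd_contraction: "\<And>(h :: real \<times> real \<Rightarrow> real) a b.
      h \<in> borel_measurable (borel \<Otimes>\<^sub>M borel) \<Longrightarrow> a \<in> borel_measurable borel \<Longrightarrow> b \<in> borel_measurable borel \<Longrightarrow>
      bounded (range h) \<Longrightarrow> bounded (range a) \<Longrightarrow> bounded (range b) \<Longrightarrow>
      (\<And>x y. h (- x, y) = - h (x, y)) \<Longrightarrow> (\<And>x y. h (x, - y) = - h (x, y)) \<Longrightarrow>
      (\<And>x. a (- x) = a x) \<Longrightarrow> (\<And>x. b (- x) = b x) \<Longrightarrow>
      (\<And>x. 0 \<le> a x) \<Longrightarrow> (\<And>x. 0 \<le> b x) \<Longrightarrow>
      (\<And>x y c. 0 < c \<Longrightarrow> h (x, y) \<le> (c * a x + b y / c) / 2) \<Longrightarrow>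
      (\<integral>w. h (X w, Y w) \<partial>\<kappa>) \<le> q * ((\<integral>w. a (X w) \<partial>\<kappa>) + (\<integral>w. b (Y w) \<partial>\<kappa>)) / 2"
begin

definition Xs :: "'i set \<Rightarrow> ('i \<Rightarrow> 'w) \<Rightarrow> 'i \<Rightarrow> real" where
  "Xs I w = (\<lambda>i\<in>I. X (w i))"

definition Ys :: "'i set \<Rightarrow> ('i \<Rightarrow> 'w) \<Rightarrow> 'i \<Rightarrow> real" where
  "Ys I w = (\<lambda>i\<in>I. Y (w i))"

lemma measurable_Xs [measurable]: "Xs I \<in> measurable (\<Pi>\<^sub>M i\<in>I. \<kappa>) (\<Pi>\<^sub>M i\<in>I. borel)"
  unfolding Xs_def by (intro measurable_restrict) measurable

lemma measurable_Ys [measurable]: "Ys I \<in> measurable (\<Pi>\<^sub>M i\<in>I. \<kappa>) (\<Pi>\<^sub>M i\<in>I. borel)"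
  unfolding Ys_def by (intro measurable_restrict) measurable

lemma Xs_upd: "i \<notin> I \<Longrightarrow> Xs (insert i I) (w(i := v)) = (Xs I w)(i := X v)"
  by (auto simp: Xs_def fun_eq_iff)

lemma Ys_upd: "i \<notin> I \<Longrightarrow> Ys (insert i I) (w(i := v)) = (Ys I w)(i := Y v)"
  by (auto simp: Ys_def fun_eq_iff)


text \<open>The new coordinate is put outermost, so that the inner integral is a function of a
  single pair (X, Y), as \<open>joint_flip\<close> and \<open>odd_contraction\<close>
  require.\<close>

lemma integral_PiM_insert_rev:
  fixes F :: "('i \<Rightarrow> 'w) \<Rightarrow> real"
  assumes I: "finite I" "i \<notin> I"
    and [measurable]: "F \<in> borel_measurable (\<Pi>\<^sub>M j\<in>insert i I. \<kappa>)" and F: "bounded (range F)"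
  shows "(\<integral>w. F w \<partial>(\<Pi>\<^sub>M j\<in>insert i I. \<kappa>)) = (\<integral>v. (\<integral>w. F (w(i := v)) \<partial>(\<Pi>\<^sub>M j\<in>I. \<kappa>)) \<partial>\<kappa>)"
proof -
  interpret P: product_prob_space "\<lambda>i. \<kappa>" UNIV by unfold_locales
  interpret Q: prob_space "\<Pi>\<^sub>M j\<in>I. \<kappa>" by (rule prob_space_PiM) unfold_locales
  interpret R: prob_space "\<Pi>\<^sub>M j\<in>insert i I. \<kappa>" by (rule prob_space_PiM) unfold_locales
  interpret S: pair_prob_space "\<Pi>\<^sub>M j\<in>I. \<kappa>" \<kappa> by unfold_locales
  have "(\<integral>w. F w \<partial>(\<Pi>\<^sub>M j\<in>insert i I. \<kappa>)) = (\<integral>w. (\<integral>v. F (w(i := v)) \<partial>\<kappa>) \<partial>(\<Pi>\<^sub>M j\<in>I. \<kappa>))"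
    using I F by (intro P.product_integral_insert R.integrable_bounded_range) auto
  also have "\<dots> = (\<integral>v. (\<integral>w. F (w(i := v)) \<partial>(\<Pi>\<^sub>M j\<in>I. \<kappa>)) \<partial>\<kappa>)"
    by (intro S.Fubini_integral[symmetric] S.P.integrable_bounded_range)
      (auto simp: case_prod_beta intro: bounded_range_comp[OF F])
  finally show ?thesis .
qed

text \<open>Splitting off one coordinate, the cross terms between even and odd parts vanish by symmetry; the
  odd part has lost one degree, which is compensated by the factor \<open>q\<close> of the contraction.\<close>

lemma noise_bound:
  assumes "finite I"
    and "f \<in> borel_measurable (\<Pi>\<^sub>M i\<in>I. borel)" "g \<in> borel_measurable (\<Pi>\<^sub>M i\<in>I. borel)"
    and "bounded (range f)" "bounded (range g)"
    and "high_degree k I f" "high_degree k I g"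
  shows "(\<integral>w. f (Xs I w) * g (Ys I w) \<partial>(\<Pi>\<^sub>M i\<in>I. \<kappa>)) \<le>
    q ^ k * ((\<integral>w. (f (Xs I w))\<^sup>2 \<partial>(\<Pi>\<^sub>M i\<in>I. \<kappa>)) + (\<integral>w. (g (Ys I w))\<^sup>2 \<partial>(\<Pi>\<^sub>M i\<in>I. \<kappa>))) / 2"
  using assms
proof (induction I arbitrary: f g k rule: finite_induct)
  case empty
  \<comment> \<open>Over no coordinates \<open>walsh\<close> is \<open>f\<close> itself, so a
    positive degree forces \<open>f\<close> to vanish.\<close>
  then have "k > 0 \<Longrightarrow> f = (\<lambda>x. 0)"
    by (auto simp: high_degree_def walsh_def)
  moreover have "u * v \<le> (u\<^sup>2 + v\<^sup>2) / 2" for u v :: real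
    using sum_squares_bound[of u v] by simp
  ultimately show ?case
    by (cases k) (auto simp: PiM_empty lebesgue_integral_count_space_finite q_nonneg)
next
  case (insert i I)
  note [measurable] = insert.prems(1,2)
  note bd = insert.prems(3,4)
  interpret P: prob_space "\<Pi>\<^sub>M j\<in>I. \<kappa>" by (rule prob_space_PiM) unfold_locales
  interpret Q: prob_space "\<Pi>\<^sub>M j\<in>insert i I. \<kappa>" by (rule prob_space_PiM) unfold_locales
  note bd_intros = bounded_range_comp[OF bd(1)] bounded_range_comp[OF bd(2)]
    bounded_range_mult bounded_plus_comp bounded_minus_comp
  have amgm: "u * v \<le> (u\<^sup>2 + v\<^sup>2) / 2" for u v :: real
    using sum_squares_bound[of u v] by simp
  show ?case
  proof (cases k)
    \<comment> \<open>No degree is available for the odd part to lose; the claim is 2uv <= u^2 +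
      v^2, integrated.\<close>
    case 0
    have "(\<integral>w. f (Xs (insert i I) w) * g (Ys (insert i I) w) \<partial>(\<Pi>\<^sub>M i\<in>insert i I. \<kappa>)) \<le>
      (\<integral>w. ((f (Xs (insert i I) w))\<^sup>2 + (g (Ys (insert i I) w))\<^sup>2) / 2 \<partial>(\<Pi>\<^sub>M i\<in>insert i I. \<kappa>))"
      unfolding power2_eq_square
      by (intro integral_mono Q.integrable_bounded_range integrable_add integrable_divide bd_intros)
        (use amgm in \<open>auto simp: power2_eq_square\<close>)
    also have "\<dots> = ((\<integral>w. (f (Xs (insert i I) w))\<^sup>2 \<partial>(\<Pi>\<^sub>M i\<in>insert i I. \<kappa>)) +
        (\<integral>w. (g (Ys (insert i I) w))\<^sup>2 \<partial>(\<Pi>\<^sub>M i\<in>insert i I. \<kappa>))) / 2"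
      unfolding power2_eq_square
      by (subst Bochner_Integration.integral_add[symmetric])
        (auto intro!: Q.integrable_bounded_range bd_intros)
    finally show ?thesis using 0 by simp
  next
    case (Suc k')
    define fe where "fe = even_part i f"
    define fo where "fo = odd_part i f"
    define ge where "ge = even_part i g"
    define go where "go = odd_part i g"
    note parts = fe_def fo_def ge_def go_def even_part_def odd_part_def
    have upd[measurable]: "(\<lambda>(u, x). f (x(i := u))) \<in> borel_measurable (borel \<Otimes>\<^sub>M (\<Pi>\<^sub>M j\<in>I. borel))"
      "(\<lambda>(u, x). g (x(i := u))) \<in> borel_measurable (borel \<Otimes>\<^sub>M (\<Pi>\<^sub>M j\<in>I. borel))"
      by (auto simp: case_prod_beta)
    have [measurable]: "(\<lambda>(u, x). fe u x) \<in> borel_measurable (borel \<Otimes>\<^sub>M (\<Pi>\<^sub>M j\<in>I. borel))"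
      "(\<lambda>(u, x). fo u x) \<in> borel_measurable (borel \<Otimes>\<^sub>M (\<Pi>\<^sub>M j\<in>I. borel))"
      "(\<lambda>(u, x). ge u x) \<in> borel_measurable (borel \<Otimes>\<^sub>M (\<Pi>\<^sub>M j\<in>I. borel))"
      "(\<lambda>(u, x). go u x) \<in> borel_measurable (borel \<Otimes>\<^sub>M (\<Pi>\<^sub>M j\<in>I. borel))"
      unfolding parts by measurable
    have meas1: "fe u \<in> borel_measurable (\<Pi>\<^sub>M j\<in>I. borel)" "fo u \<in> borel_measurable (\<Pi>\<^sub>M j\<in>I. borel)"
      "ge u \<in> borel_measurable (\<Pi>\<^sub>M j\<in>I. borel)" "go u \<in> borel_measurable (\<Pi>\<^sub>M j\<in>I. borel)" for u
      unfolding parts by measurable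
    have deg: "high_degree k I (fe u)" "high_degree k I (ge u)"
      "high_degree k' I (fo u)" "high_degree k' I (go u)" for u
      unfolding fe_def ge_def fo_def go_def using insert.hyps insert.prems(5,6) Suc
      by (auto intro: high_degree_even_part high_degree_odd_part)
    have sym: "fe (- u) x = fe u x" "fo (- u) x = - fo u x" "ge (- u) x = ge u x" "go (- u) x = - go u x"
      for u x by (simp_all add: parts field_simps)
    have bd_parts: "bounded (range (\<lambda>y. fe (a y) (b y)))" "bounded (range (\<lambda>y. fo (a y) (b y)))"
      "bounded (range (\<lambda>y. ge (a y) (b y)))" "bounded (range (\<lambda>y. go (a y) (b y)))"
      for a :: "'y \<Rightarrow> real" and b
      unfolding parts divide_inverse by (intro bd_intros; simp)+
    note bd_intros = bd_intros bd_parts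
    \<comment> \<open>In these integrals u and v are the values of the split-off coordinate in the
      two copies; all other coordinates are integrated out.\<close>
    define H where "H = (\<lambda>(u, v). \<integral>w. f ((Xs I w)(i := u)) * g ((Ys I w)(i := v)) \<partial>(\<Pi>\<^sub>M j\<in>I. \<kappa>))"
    define He where "He = (\<lambda>(u, v). \<integral>w. fe u (Xs I w) * ge v (Ys I w) \<partial>(\<Pi>\<^sub>M j\<in>I. \<kappa>))"
    define Ho where "Ho = (\<lambda>(u, v). \<integral>w. fo u (Xs I w) * go v (Ys I w) \<partial>(\<Pi>\<^sub>M j\<in>I. \<kappa>))"
    define F where "F u = (\<integral>w. (f ((Xs I w)(i := u)))\<^sup>2 \<partial>(\<Pi>\<^sub>M j\<in>I. \<kappa>))" for u
    define Fe where "Fe u = (\<integral>w. (fe u (Xs I w))\<^sup>2 \<partial>(\<Pi>\<^sub>M j\<in>I. \<kappa>))" for u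
    define Fo where "Fo u = (\<integral>w. (fo u (Xs I w))\<^sup>2 \<partial>(\<Pi>\<^sub>M j\<in>I. \<kappa>))" for u
    define G where "G u = (\<integral>w. (g ((Ys I w)(i := u)))\<^sup>2 \<partial>(\<Pi>\<^sub>M j\<in>I. \<kappa>))" for u
    define Ge where "Ge u = (\<integral>w. (ge u (Ys I w))\<^sup>2 \<partial>(\<Pi>\<^sub>M j\<in>I. \<kappa>))" for u
    define Go where "Go u = (\<integral>w. (go u (Ys I w))\<^sup>2 \<partial>(\<Pi>\<^sub>M j\<in>I. \<kappa>))" for u
    note defs = H_def He_def Ho_def F_def Fe_def Fo_def G_def Ge_def Go_def
    have [measurable]: "H \<in> borel_measurable (borel \<Otimes>\<^sub>M borel)" "He \<in> borel_measurable (borel \<Otimes>\<^sub>M borel)"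
      "Ho \<in> borel_measurable (borel \<Otimes>\<^sub>M borel)" "F \<in> borel_measurable borel" "Fe \<in> borel_measurable borel"
      "Fo \<in> borel_measurable borel" "G \<in> borel_measurable borel" "Ge \<in> borel_measurable borel"
      "Go \<in> borel_measurable borel"
      unfolding defs case_prod_beta by measurable
    have bdH: "bounded (range H)" "bounded (range He)" "bounded (range Ho)" "bounded (range F)" "bounded (range Fe)"
      "bounded (range Fo)" "bounded (range G)" "bounded (range Ge)" "bounded (range Go)"
      unfolding defs case_prod_beta power2_eq_square by (intro P.bounded_range_integral bd_intros)+
    note int = integrable_bounded_range[OF _ bounded_range_comp[OF bdH(1)]]
      integrable_bounded_range[OF _ bounded_range_comp[OF bdH(2)]]
      integrable_bounded_range[OF _ bounded_range_comp[OF bdH(3)]]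
      integrable_bounded_range[OF _ bounded_range_comp[OF bdH(4)]]
      integrable_bounded_range[OF _ bounded_range_comp[OF bdH(5)]]
      integrable_bounded_range[OF _ bounded_range_comp[OF bdH(6)]]
      integrable_bounded_range[OF _ bounded_range_comp[OF bdH(7)]]
      integrable_bounded_range[OF _ bounded_range_comp[OF bdH(8)]]
      integrable_bounded_range[OF _ bounded_range_comp[OF bdH(9)]]
    \<comment> \<open>Adding the values at (u, v) and at (-u, -v) cancels the products of an even
      with an odd part.\<close>
    have H_split: "H (u, v) + H (- u, - v) = 2 * (He (u, v) + Ho (u, v))" for u v
    proof -
      have "H (u, v) + H (- u, - v) = (\<integral>w. f ((Xs I w)(i := u)) * g ((Ys I w)(i := v)) + f ((Xs I w)(i := - u)) * g ((Ys I w)(i := - v)) \<partial>(\<Pi>\<^sub>M j\<in>I. \<kappa>))"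
        unfolding H_def prod.case power2_eq_square
        by (intro Bochner_Integration.integral_add[symmetric] P.integrable_bounded_range bd_intros) measurable
      also have "\<dots> = (\<integral>w. 2 * (fe u (Xs I w) * ge v (Ys I w) + fo u (Xs I w) * go v (Ys I w)) \<partial>(\<Pi>\<^sub>M j\<in>I. \<kappa>))"
        by (intro Bochner_Integration.integral_cong refl) (simp add: parts power2_eq_square field_simps)
      also have "\<dots> = 2 * ((\<integral>w. fe u (Xs I w) * ge v (Ys I w) \<partial>(\<Pi>\<^sub>M j\<in>I. \<kappa>)) + (\<integral>w. fo u (Xs I w) * go v (Ys I w) \<partial>(\<Pi>\<^sub>M j\<in>I. \<kappa>)))"
        unfolding power2_eq_square
        by (subst integral_mult_right_zero, subst Bochner_Integration.integral_add)
          (auto intro!: P.integrable_bounded_range bd_intros)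
      finally show ?thesis by (simp add: defs power2_eq_square)
    qed
    have F_split: "F u + F (- u) = 2 * (Fe u + Fo u)" for u
    proof -
      have "F u + F (- u) = (\<integral>w. (f ((Xs I w)(i := u)))\<^sup>2 + (f ((Xs I w)(i := - u)))\<^sup>2 \<partial>(\<Pi>\<^sub>M j\<in>I. \<kappa>))"
        unfolding F_def prod.case power2_eq_square
        by (intro Bochner_Integration.integral_add[symmetric] P.integrable_bounded_range bd_intros) measurable
      also have "\<dots> = (\<integral>w. 2 * ((fe u (Xs I w))\<^sup>2 + (fo u (Xs I w))\<^sup>2) \<partial>(\<Pi>\<^sub>M j\<in>I. \<kappa>))"
        by (intro Bochner_Integration.integral_cong refl) (simp add: parts power2_eq_square field_simps)
      also have "\<dots> = 2 * ((\<integral>w. (fe u (Xs I w))\<^sup>2 \<partial>(\<Pi>\<^sub>M j\<in>I. \<kappa>)) + (\<integral>w. (fo u (Xs I w))\<^sup>2 \<partial>(\<Pi>\<^sub>M j\<in>I. \<kappa>)))"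
        unfolding power2_eq_square
        by (subst integral_mult_right_zero, subst Bochner_Integration.integral_add)
          (auto intro!: P.integrable_bounded_range bd_intros)
      finally show ?thesis by (simp add: defs power2_eq_square)
    qed
    have G_split: "G u + G (- u) = 2 * (Ge u + Go u)" for u
    proof -
      have "G u + G (- u) = (\<integral>w. (g ((Ys I w)(i := u)))\<^sup>2 + (g ((Ys I w)(i := - u)))\<^sup>2 \<partial>(\<Pi>\<^sub>M j\<in>I. \<kappa>))"
        unfolding G_def prod.case power2_eq_square
        by (intro Bochner_Integration.integral_add[symmetric] P.integrable_bounded_range bd_intros) measurable
      also have "\<dots> = (\<integral>w. 2 * ((ge u (Ys I w))\<^sup>2 + (go u (Ys I w))\<^sup>2) \<partial>(\<Pi>\<^sub>M j\<in>I. \<kappa>))"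
        by (intro Bochner_Integration.integral_cong refl) (simp add: parts power2_eq_square field_simps)
      also have "\<dots> = 2 * ((\<integral>w. (ge u (Ys I w))\<^sup>2 \<partial>(\<Pi>\<^sub>M j\<in>I. \<kappa>)) + (\<integral>w. (go u (Ys I w))\<^sup>2 \<partial>(\<Pi>\<^sub>M j\<in>I. \<kappa>)))"
        unfolding power2_eq_square
        by (subst integral_mult_right_zero, subst Bochner_Integration.integral_add)
          (auto intro!: P.integrable_bounded_range bd_intros)
      finally show ?thesis by (simp add: defs power2_eq_square)
    qed
    have EH: "(\<integral>v. H (X v, Y v) \<partial>\<kappa>) = (\<integral>v. He (X v, Y v) \<partial>\<kappa>) + (\<integral>v. Ho (X v, Y v) \<partial>\<kappa>)"
    proof -
      have "2 * (\<integral>v. H (X v, Y v) \<partial>\<kappa>) = (\<integral>v. H (X v, Y v) \<partial>\<kappa>) + (\<integral>v. H (- X v, - Y v) \<partial>\<kappa>)"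
        using joint_flip[of H] bdH by simp
      also have "\<dots> = (\<integral>v. H (X v, Y v) + H (- X v, - Y v) \<partial>\<kappa>)"
        by (intro Bochner_Integration.integral_add[symmetric] int) measurable
      also have "\<dots> = (\<integral>v. 2 * (He (X v, Y v) + Ho (X v, Y v)) \<partial>\<kappa>)"
        by (simp only: H_split)
      also have "\<dots> = 2 * ((\<integral>v. He (X v, Y v) \<partial>\<kappa>) + (\<integral>v. Ho (X v, Y v) \<partial>\<kappa>))"
        by (subst integral_mult_right_zero, subst Bochner_Integration.integral_add) (auto intro!: int)
      finally show ?thesis by simp
    qed
    have EF: "(\<integral>v. F (X v) \<partial>\<kappa>) = (\<integral>v. Fe (X v) \<partial>\<kappa>) + (\<integral>v. Fo (X v) \<partial>\<kappa>)"
    proof -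
      \<comment> \<open>\<open>joint_flip\<close> for a function of the first variable alone says
        that \<open>X\<close> is symmetric.\<close>
      have "2 * (\<integral>v. F (X v) \<partial>\<kappa>) = (\<integral>v. F (X v) \<partial>\<kappa>) + (\<integral>v. F (- X v) \<partial>\<kappa>)"
        using joint_flip[of "\<lambda>p. F (fst p)"] bounded_range_comp[OF bdH(4), of "fst :: real \<times> real \<Rightarrow> real"] by simp
      also have "\<dots> = (\<integral>v. F (X v) + F (- X v) \<partial>\<kappa>)"
        by (intro Bochner_Integration.integral_add[symmetric] int) measurable
      also have "\<dots> = (\<integral>v. 2 * (Fe (X v) + Fo (X v)) \<partial>\<kappa>)"
        by (simp only: F_split)
      also have "\<dots> = 2 * ((\<integral>v. Fe (X v) \<partial>\<kappa>) + (\<integral>v. Fo (X v) \<partial>\<kappa>))"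
        by (subst integral_mult_right_zero, subst Bochner_Integration.integral_add) (auto intro!: int)
      finally show ?thesis by simp
    qed
    have EG: "(\<integral>v. G (Y v) \<partial>\<kappa>) = (\<integral>v. Ge (Y v) \<partial>\<kappa>) + (\<integral>v. Go (Y v) \<partial>\<kappa>)"
    proof -
      have "2 * (\<integral>v. G (Y v) \<partial>\<kappa>) = (\<integral>v. G (Y v) \<partial>\<kappa>) + (\<integral>v. G (- Y v) \<partial>\<kappa>)"
        using joint_flip[of "\<lambda>p. G (snd p)"] bounded_range_comp[OF bdH(7), of "snd :: real \<times> real \<Rightarrow> real"] by simp
      also have "\<dots> = (\<integral>v. G (Y v) + G (- Y v) \<partial>\<kappa>)"
        by (intro Bochner_Integration.integral_add[symmetric] int) measurable
      also have "\<dots> = (\<integral>v. 2 * (Ge (Y v) + Go (Y v)) \<partial>\<kappa>)"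
        by (simp only: G_split)
      also have "\<dots> = 2 * ((\<integral>v. Ge (Y v) \<partial>\<kappa>) + (\<integral>v. Go (Y v) \<partial>\<kappa>))"
        by (subst integral_mult_right_zero, subst Bochner_Integration.integral_add) (auto intro!: int)
      finally show ?thesis by simp
    qed
    have He_le: "He (u, v) \<le> q ^ k * (Fe u + Ge v) / 2" for u v
      unfolding He_def Fe_def Ge_def prod.case
      by (intro insert.IH meas1 deg bd_parts)
    \<comment> \<open>Scaling one factor by sqrt c and the other by 1 / sqrt c leaves the product
      unchanged, so the induction hypothesis gives a bound for every c > 0. This is the origin of
      the linearised assumption in \<open>odd_contraction\<close>.\<close>
    have Ho_le: "Ho (u, v) \<le> (c * (q ^ k' * Fo u) + (q ^ k' * Go v) / c) / 2" if c: "c > 0" for u v c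
    proof -
      have "Ho (u, v) = (\<integral>w. (sqrt c * fo u (Xs I w)) * (1 / sqrt c * go v (Ys I w)) \<partial>(\<Pi>\<^sub>M j\<in>I. \<kappa>))"
        using c by (simp add: Ho_def)
      also have "\<dots> \<le> q ^ k' * ((\<integral>w. (sqrt c * fo u (Xs I w))\<^sup>2 \<partial>(\<Pi>\<^sub>M i\<in>I. \<kappa>)) +
        (\<integral>w. (1 / sqrt c * go v (Ys I w))\<^sup>2 \<partial>(\<Pi>\<^sub>M i\<in>I. \<kappa>))) / 2"
        by (intro insert.IH high_degree_mult bounded_range_mult bd_parts deg) (auto intro: meas1)
      also have "\<dots> = (c * (q ^ k' * Fo u) + (q ^ k' * Go v) / c) / 2"
        using c by (simp add: power_mult_distrib Fo_def Go_def power_divide field_simps)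
      finally show ?thesis .
    qed
    have nonneg: "0 \<le> Fo u" "0 \<le> Go u" for u
      by (simp_all add: Fo_def Go_def)
    have "(\<integral>v. He (X v, Y v) \<partial>\<kappa>) \<le> (\<integral>v. q ^ k * (Fe (X v) + Ge (Y v)) / 2 \<partial>\<kappa>)"
      by (intro integral_mono He_le int integrable_mult_right integrable_divide Bochner_Integration.integrable_add) measurable
    also have "\<dots> = q ^ k * ((\<integral>v. Fe (X v) \<partial>\<kappa>) + (\<integral>v. Ge (Y v) \<partial>\<kappa>)) / 2"
    proof -
      have "(\<integral>v. Fe (X v) + Ge (Y v) \<partial>\<kappa>) = (\<integral>v. Fe (X v) \<partial>\<kappa>) + (\<integral>v. Ge (Y v) \<partial>\<kappa>)"
        by (intro Bochner_Integration.integral_add int) measurable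
      then show ?thesis
        by (simp only: integral_divide_zero integral_mult_right_zero)
    qed
    finally have e: "(\<integral>v. He (X v, Y v) \<partial>\<kappa>) \<le> q ^ k * ((\<integral>v. Fe (X v) \<partial>\<kappa>) + (\<integral>v. Ge (Y v) \<partial>\<kappa>)) / 2" .
    \<comment> \<open>The power \<open>q ^ k'\<close> from the induction hypothesis sits inside the
      two envelopes; the contraction supplies the missing factor \<open>q\<close>.\<close>
    have "(\<integral>v. Ho (X v, Y v) \<partial>\<kappa>) \<le> q * ((\<integral>v. q ^ k' * Fo (X v) \<partial>\<kappa>) + (\<integral>v. q ^ k' * Go (Y v) \<partial>\<kappa>)) / 2"
    proof (rule odd_contraction)
      show "Ho (x, y) \<le> (c * (q ^ k' * Fo x) + q ^ k' * Go y / c) / 2" if "c > 0" for x y c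
        using Ho_le[OF that, of x y] by simp
    qed (auto simp: nonneg q_nonneg Ho_def Fo_def Go_def sym bdH(3,6,9)[unfolded Ho_def Fo_def Go_def] intro!: bounded_range_mult)
    also have "\<dots> = q ^ k * ((\<integral>v. Fo (X v) \<partial>\<kappa>) + (\<integral>v. Go (Y v) \<partial>\<kappa>)) / 2"
      using Suc by (simp add: algebra_simps)
    finally have o: "(\<integral>v. Ho (X v, Y v) \<partial>\<kappa>) \<le> q ^ k * ((\<integral>v. Fo (X v) \<partial>\<kappa>) + (\<integral>v. Go (Y v) \<partial>\<kappa>)) / 2" .
    have "(\<integral>w. f (Xs (insert i I) w) * g (Ys (insert i I) w) \<partial>(\<Pi>\<^sub>M i\<in>insert i I. \<kappa>)) = (\<integral>v. H (X v, Y v) \<partial>\<kappa>)"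
      using insert.hyps
      by (subst integral_PiM_insert_rev) (auto simp: H_def Xs_upd Ys_upd intro!: bd_intros)
    also have "\<dots> \<le> q ^ k * ((\<integral>v. F (X v) \<partial>\<kappa>) + (\<integral>v. G (Y v) \<partial>\<kappa>)) / 2"
      using e o unfolding EH EF EG by (simp add: algebra_simps)
    also have "(\<integral>v. F (X v) \<partial>\<kappa>) = (\<integral>w. (f (Xs (insert i I) w))\<^sup>2 \<partial>(\<Pi>\<^sub>M i\<in>insert i I. \<kappa>))"
      using insert.hyps unfolding F_def power2_eq_square
      by (subst integral_PiM_insert_rev) (auto simp: Xs_upd intro!: bd_intros)
    also have "(\<integral>v. G (Y v) \<partial>\<kappa>) = (\<integral>w. (g (Ys (insert i I) w))\<^sup>2 \<partial>(\<Pi>\<^sub>M i\<in>insert i I. \<kappa>))"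
      using insert.hyps unfolding G_def power2_eq_square
      by (subst integral_PiM_insert_rev) (auto simp: Ys_upd intro!: bd_intros)
    finally show ?thesis .
  qed
qed

end

subsection \<open>The Gaussian and the resampling perturbation\<close>

abbreviation std_gaussian :: "real measure" where
  "std_gaussian \<equiv> density lborel std_normal_density"

locale gaussian_pair =
  fixes q r :: real
  assumes q: "0 \<le> q" and r: "0 < r" and qr: "q\<^sup>2 + r\<^sup>2 = 1"
begin

text \<open>Transition density of the Ornstein-Uhlenbeck step from x to q x + r Z with Z standard
  Gaussian: the Mehler kernel relative to Lebesgue measure.\<close>

definition kern :: "real \<Rightarrow> real \<Rightarrow> real" where
  "kern x y = normal_density (q * x) r y"

text \<open>Twice the odd part of the kernel in y. Against an odd function of y it integrates to
  twice what \<open>kern\<close> does.\<close>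

definition folded :: "real \<Rightarrow> real \<Rightarrow> real" where
  "folded x y = kern x y - kern x (- y)"

lemma kern_measurable [measurable]: "(\<lambda>(x, y). kern x y) \<in> borel_measurable (borel \<Otimes>\<^sub>M borel)"
  unfolding kern_def normal_density_def by measurable

lemma folded_measurable [measurable]: "(\<lambda>(x, y). folded x y) \<in> borel_measurable (borel \<Otimes>\<^sub>M borel)"
  unfolding folded_def by measurable

lemma kern_nonneg [simp]: "0 \<le> kern x y"
  by (simp add: kern_def)

lemma kern_uminus: "kern (- x) (- y) = kern x y"
  by (simp add: kern_def normal_density_def power2_commute)

text \<open>Detailed balance: because q^2 + r^2 = 1, the quadratic form in the joint exponent is
  symmetric in x and y.\<close>

lemma kern_symmetric: "std_normal_density x * kern x y = std_normal_density y * kern y x"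
proof -
  have "x\<^sup>2 / 2 + (y - q * x)\<^sup>2 / (2 * r\<^sup>2) = y\<^sup>2 / 2 + (x - q * y)\<^sup>2 / (2 * r\<^sup>2)"
  proof -
    have "x\<^sup>2 * r\<^sup>2 + (y - q * x)\<^sup>2 = x\<^sup>2 * (q\<^sup>2 + r\<^sup>2) + y\<^sup>2 - 2 * q * x * y"
      by (simp add: power2_eq_square algebra_simps)
    moreover have "y\<^sup>2 * r\<^sup>2 + (x - q * y)\<^sup>2 = y\<^sup>2 * (q\<^sup>2 + r\<^sup>2) + x\<^sup>2 - 2 * q * x * y"
      by (simp add: power2_eq_square algebra_simps)
    ultimately have "x\<^sup>2 * r\<^sup>2 + (y - q * x)\<^sup>2 = y\<^sup>2 * r\<^sup>2 + (x - q * y)\<^sup>2"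
      by (simp add: qr)
    then have "(x\<^sup>2 * r\<^sup>2 + (y - q * x)\<^sup>2) / (2 * r\<^sup>2) = (y\<^sup>2 * r\<^sup>2 + (x - q * y)\<^sup>2) / (2 * r\<^sup>2)"
      by simp
    then show ?thesis using r by (simp add: add_divide_distrib)
  qed
  then have "exp (- (x\<^sup>2 / 2)) * exp (- ((y - q * x)\<^sup>2 / (2 * r\<^sup>2))) =
      exp (- (y\<^sup>2 / 2)) * exp (- ((x - q * y)\<^sup>2 / (2 * r\<^sup>2)))"
    by (simp flip: exp_add)
  then show ?thesis
    by (simp add: kern_def normal_density_def)
qed

lemma folded_symmetric: "std_normal_density x * folded x y = std_normal_density y * folded y x"
  using kern_symmetric[of x y] kern_symmetric[of x "- y"] kern_uminus[of y "- x"]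
  by (simp add: folded_def right_diff_distrib normal_density_def)

lemma kern_mono: "0 \<le> x * y \<Longrightarrow> kern x (- y) \<le> kern x y"
proof -
  assume "0 \<le> x * y"
  then have "0 \<le> 4 * (q * (x * y))" using q by simp
  then have "(y - q * x)\<^sup>2 \<le> (- y - q * x)\<^sup>2"
    by (simp add: power2_eq_square algebra_simps)
  then show ?thesis
    using r by (simp add: kern_def normal_density_def divide_right_mono mult_left_mono)
qed

text \<open>The density \<open>kern x\<close> is centred at q x, on the side of x, so
  \<open>folded x y\<close> has the sign of x y. This resolves the absolute values that the Schur
  test introduces.\<close>

lemma folded_sign: "\<bar>y\<bar> * \<bar>folded x y\<bar> = sgn x * (y * folded x y)"
proof -
  have "kern 0 (- y) = kern 0 y" by (simp add: kern_def normal_density_def)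
  then show ?thesis
    using kern_mono[of x y] kern_mono[of x "- y"]
    by (cases x "0 :: real" rule: linorder_cases; cases y "0 :: real" rule: linorder_cases)
      (auto simp: folded_def abs_if mult_nonneg_nonneg mult_nonpos_nonpos mult_nonneg_nonpos mult_nonpos_nonneg algebra_simps)
qed

lemma kern_moment: "has_bochner_integral lborel (\<lambda>y. y * kern x y) (q * x)"
  using normal_moment_nz_1[OF r, of "q * x"] by (simp add: kern_def mult.commute)

text \<open>The mean of \<open>kern x\<close> is q x, and the reflected term contributes the same
  amount again; hence the weight |x| is reproduced with the factor 2 q.\<close>

lemma folded_moment: "has_bochner_integral lborel (\<lambda>y. \<bar>y\<bar> * \<bar>folded x y\<bar>) (2 * q * \<bar>x\<bar>)"
proof -
  have "has_bochner_integral lborel (\<lambda>y. (- y) * kern x (- y)) (q * x)"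
    using lborel_has_bochner_integral_real_affine_iff[of "-1" "\<lambda>y. y * kern x y" "q * x" 0] kern_moment[of x] by simp
  from has_bochner_integral_add[OF kern_moment[of x] this]
  have "has_bochner_integral lborel (\<lambda>y. y * folded x y) (2 * q * x)"
    by (simp add: folded_def algebra_simps)
  then have "has_bochner_integral lborel (\<lambda>y. sgn x * (y * folded x y)) (sgn x * (2 * q * x))"
    by (intro has_bochner_integral_mult_right)
  moreover have "sgn x * (2 * q * x) = 2 * q * \<bar>x\<bar>"
    by (simp add: abs_sgn)
  ultimately show ?thesis by (simp only: folded_sign)
qed

lemma integrable_bounded_normal:
  fixes f :: "real \<Rightarrow> real"
  assumes "f \<in> borel_measurable borel" "bounded (range f)" "s > 0"
  shows "integrable lborel (\<lambda>x. normal_density m s x * f x)"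
proof -
  obtain B where B: "\<And>x. \<bar>f x\<bar> \<le> B"
    using assms(2) by (auto simp: bounded_iff)
  show ?thesis
  proof (rule Bochner_Integration.integrable_bound)
    show "integrable lborel (\<lambda>x. normal_density m s x * B)"
      using assms(3) by simp
  qed (use assms(1) B in \<open>auto simp: abs_mult intro!: mult_left_mono AE_I2 order_trans[OF B]\<close>)
qed

text \<open>Schur test with the weight \<open>|x|\<close>, the positive eigenfunction (for the eigenvalue \<open>q\<close>)
  of the kernel folded onto odd functions. At \<open>x = 0\<close> the quotient is \<open>0\<close>.\<close>

definition schur :: "(real \<Rightarrow> real) \<Rightarrow> real \<times> real \<Rightarrow> real" where
  "schur a = (\<lambda>(x, y). a x * std_normal_density x / \<bar>x\<bar> * (\<bar>y\<bar> * \<bar>folded x y\<bar>))"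

lemma schur_integral:
  assumes [measurable]: "a \<in> borel_measurable borel" and a: "bounded (range a)" "\<And>x. 0 \<le> a x"
  shows "has_bochner_integral (lborel \<Otimes>\<^sub>M lborel) (schur a)
    (2 * q * (\<integral>x. std_normal_density x * a x \<partial>lborel))"
proof -
  have m [measurable]: "schur a \<in> borel_measurable (lborel \<Otimes>\<^sub>M lborel)"
    unfolding schur_def by measurable
  have inner: "has_bochner_integral lborel (\<lambda>y. schur a (x, y)) (a x * std_normal_density x / \<bar>x\<bar> * (2 * q * \<bar>x\<bar>))" for x
    unfolding schur_def prod.case by (intro has_bochner_integral_mult_right folded_moment)
  have norm: "\<bar>schur a p\<bar> = schur a p" for p
    using a(2) by (auto simp: schur_def split: prod.split)
  \<comment> \<open>At x = 0 the division by zero makes the left side 0, so the sides agree only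
    almost everywhere.\<close>
  have ae: "AE x in lborel. a x * std_normal_density x / \<bar>x\<bar> * (2 * q * \<bar>x\<bar>) = 2 * q * (std_normal_density x * a x)"
    using AE_lborel_singleton[of 0] by eventually_elim auto
  have int: "integrable lborel (\<lambda>x. 2 * q * (std_normal_density x * a x))"
    using integrable_bounded_normal[of a 1 0] a by simp
  have "integrable lborel (\<lambda>x. a x * std_normal_density x / \<bar>x\<bar> * (2 * q * \<bar>x\<bar>))"
    using ae int by (subst integrable_cong_AE[where g = "\<lambda>x. 2 * q * (std_normal_density x * a x)"]) auto
  then have "integrable (lborel \<Otimes>\<^sub>M lborel) (schur a)"
    using inner
    by (intro lborel_pair.Fubini_integrable m) (auto simp: norm has_bochner_integral_iff)
  moreover from this have "integral\<^sup>L (lborel \<Otimes>\<^sub>M lborel) (schur a) =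
      (\<integral>x. a x * std_normal_density x / \<bar>x\<bar> * (2 * q * \<bar>x\<bar>) \<partial>lborel)"
    using inner by (subst lborel_pair.integral_fst'[symmetric]) (auto simp: has_bochner_integral_iff)
  moreover have "\<dots> = (\<integral>x. 2 * q * (std_normal_density x * a x) \<partial>lborel)"
    by (rule integral_cong_AE[OF _ _ ae]) auto
  ultimately show ?thesis
    by (simp add: has_bochner_integral_iff)
qed

lemma schur_bound:
  assumes "\<And>x y. h (- x, y) = - h (x, y)" "\<And>x y. h (x, - y) = - h (x, y)"
    and "\<And>x. a (- x) = a x" "\<And>x. 0 \<le> a x" "\<And>x. 0 \<le> b x"
    and le: "\<And>x y c. 0 < c \<Longrightarrow> h (x, y) \<le> (c * a x + b y / c) / 2"
  shows "std_normal_density x * folded x y * h (x, y) \<le> (schur a (x, y) + schur b (y, x)) / 2"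
proof (cases "x = 0 \<or> y = 0")
  case True
  \<comment> \<open>On the axes the ratio of weights degenerates, but there an odd h
    vanishes.\<close>
  have "h (0, y) = 0" "h (x, 0) = 0"
    using assms(1)[of 0 y] assms(2)[of x 0] by auto
  with True have "std_normal_density x * folded x y * h (x, y) = 0" by auto
  moreover have "0 \<le> (schur a (x, y) + schur b (y, x)) / 2"
    using assms by (simp add: schur_def)
  ultimately show ?thesis by (simp only:)
next
  case False
  \<comment> \<open>With this ratio, c a(x) and b(y) / c become the Schur weights a(x) |y| / |x| and
    b(y) |x| / |y|.\<close>
  define c where "c = \<bar>y\<bar> / \<bar>x\<bar>"
  have c: "c > 0" using False by (simp add: c_def)
  \<comment> \<open>The bound at (-x, y) controls -h(x, y), since h is odd and a is even.\<close>
  have "\<bar>h (x, y)\<bar> \<le> (c * a x + b y / c) / 2"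
    using le[OF c, of x y] le[OF c, of "- x" y] assms(1,3) by simp
  then have "std_normal_density x * \<bar>folded x y\<bar> * \<bar>h (x, y)\<bar> \<le>
      std_normal_density x * \<bar>folded x y\<bar> * ((c * a x + b y / c) / 2)"
    by (intro mult_left_mono) auto
  moreover have "std_normal_density x * folded x y * h (x, y) \<le> std_normal_density x * \<bar>folded x y\<bar> * \<bar>h (x, y)\<bar>"
    by (metis abs_ge_self abs_mult abs_of_nonneg normal_density_nonneg)
  moreover have "std_normal_density x * \<bar>folded x y\<bar> * (b y / c) = b y / \<bar>y\<bar> * \<bar>x\<bar> * (std_normal_density x * \<bar>folded x y\<bar>)"
    by (simp add: c_def)
  \<comment> \<open>Detailed balance moves the Gaussian weight from x to y, where
    \<open>schur b (y, x)\<close> has it.\<close>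
  moreover have "std_normal_density x * \<bar>folded x y\<bar> = std_normal_density y * \<bar>folded y x\<bar>"
    using arg_cong[OF folded_symmetric[of x y], of abs] by (simp add: abs_mult)
  ultimately show ?thesis
    by (simp add: schur_def c_def field_simps)
qed

lemma integral_shift:
  fixes f :: "real \<Rightarrow> real"
  assumes [measurable]: "f \<in> borel_measurable borel"
  shows "(\<integral>z. f (q * x + r * z) \<partial>std_gaussian) = (\<integral>y. kern x y * f y \<partial>lborel)"
proof -
  interpret prob_space std_gaussian by (rule prob_space_normal_density) simp
  have "distributed std_gaussian lborel (\<lambda>z. z) std_normal_density"
    by (auto simp: distributed_def distr_id2 normal_density_nonneg)
  then have "distributed std_gaussian lborel (\<lambda>z. q * x + r * z) (normal_density (q * x + r * 0) (\<bar>r\<bar> * 1))"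
    using r by (intro normal_density_affine) auto
  then have eq: "distr std_gaussian lborel (\<lambda>z. q * x + r * z) = density lborel (\<lambda>y. ennreal (kern x y))"
    using r by (simp add: distributed_def kern_def)
  have "(\<integral>z. f (q * x + r * z) \<partial>std_gaussian) = integral\<^sup>L (distr std_gaussian lborel (\<lambda>z. q * x + r * z)) f"
    by (subst integral_distr) auto
  also have "\<dots> = (\<integral>y. kern x y * f y \<partial>lborel)"
    unfolding eq by (subst integral_density) auto
  finally show ?thesis .
qed

lemma integrable_joint:
  fixes h :: "real \<times> real \<Rightarrow> real"
  assumes [measurable]: "h \<in> borel_measurable (borel \<Otimes>\<^sub>M borel)" and h: "bounded (range h)"
  shows "integrable (lborel \<Otimes>\<^sub>M lborel) (\<lambda>(x, y). std_normal_density x * kern x y * h (x, y))"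
proof -
  obtain B where B: "\<And>p. \<bar>h p\<bar> \<le> B"
    using h by (auto simp: bounded_iff)
  have "integrable (lborel \<Otimes>\<^sub>M lborel) (\<lambda>(x, y). std_normal_density x * kern x y)"
  proof (rule lborel_pair.Fubini_integrable)
    have "integrable lborel (kern x)" "(\<integral>y. kern x y \<partial>lborel) = 1" for x
      using r unfolding kern_def by auto
    then show "integrable lborel (\<lambda>x. \<integral>y. norm (case (x, y) of (x, y) \<Rightarrow> std_normal_density x * kern x y) \<partial>lborel)"
      "AE x in lborel. integrable lborel (\<lambda>y. case (x, y) of (x, y) \<Rightarrow> std_normal_density x * kern x y)"
      by (auto simp: abs_mult)
  qed measurable
  then have "integrable (lborel \<Otimes>\<^sub>M lborel) (\<lambda>p. B * (case p of (x, y) \<Rightarrow> std_normal_density x * kern x y))"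
    by simp
  then show ?thesis
  proof (rule Bochner_Integration.integrable_bound)
    show "AE p in lborel \<Otimes>\<^sub>M lborel. norm (case p of (x, y) \<Rightarrow> std_normal_density x * kern x y * h (x, y)) \<le>
      norm (B * (case p of (x, y) \<Rightarrow> std_normal_density x * kern x y))"
      using B order_trans[OF abs_ge_zero B]
      by (intro AE_I2) (auto simp: abs_mult mult.commute[of B] intro!: mult_left_mono)
  qed measurable
qed

lemma integral_joint:
  fixes h :: "real \<times> real \<Rightarrow> real"
  assumes [measurable]: "h \<in> borel_measurable (borel \<Otimes>\<^sub>M borel)" and h: "bounded (range h)"
  shows "(\<integral>x. (\<integral>z. h (x, q * x + r * z) \<partial>std_gaussian) \<partial>std_gaussian) =
    (\<integral>(x, y). std_normal_density x * kern x y * h (x, y) \<partial>(lborel \<Otimes>\<^sub>M lborel))"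
proof -
  have "(\<integral>x. (\<integral>z. h (x, q * x + r * z) \<partial>std_gaussian) \<partial>std_gaussian) =
      (\<integral>x. (\<integral>y. kern x y * h (x, y) \<partial>lborel) \<partial>std_gaussian)"
    by (intro Bochner_Integration.integral_cong refl integral_shift) measurable
  also have "\<dots> = (\<integral>x. (\<integral>y. std_normal_density x * kern x y * h (x, y) \<partial>lborel) \<partial>lborel)"
    by (subst integral_density) (auto simp: mult.assoc)
  also have "\<dots> = (\<integral>(x, y). std_normal_density x * kern x y * h (x, y) \<partial>(lborel \<Otimes>\<^sub>M lborel))"
    using lborel_pair.integral_fst'[OF integrable_joint[OF assms]] by simp
  finally show ?thesis .
qed

text \<open>Stationarity: after detailed balance the inner integral is over the density
  \<open>kern y\<close>, which has mass 1.\<close>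

lemma integral_snd_joint:
  fixes b :: "real \<Rightarrow> real"
  assumes [measurable]: "b \<in> borel_measurable borel" and b: "bounded (range b)"
  shows "(\<integral>x. (\<integral>z. b (q * x + r * z) \<partial>std_gaussian) \<partial>std_gaussian) = (\<integral>y. std_normal_density y * b y \<partial>lborel)"
proof -
  note int = integrable_joint[of "\<lambda>p. b (snd p)", OF _ bounded_range_comp[OF b]]
  have "(\<integral>x. (\<integral>z. b (q * x + r * z) \<partial>std_gaussian) \<partial>std_gaussian) =
    (\<integral>(x, y). std_normal_density x * kern x y * b y \<partial>(lborel \<Otimes>\<^sub>M lborel))"
    using integral_joint[of "\<lambda>p. b (snd p)", OF _ bounded_range_comp[OF b]] by simp
  also have "\<dots> = (\<integral>y. (\<integral>x. std_normal_density x * kern x y * b y \<partial>lborel) \<partial>lborel)"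
    using lborel_pair.integral_snd[of "\<lambda>x y. std_normal_density x * kern x y * b y"] int by simp
  also have "\<dots> = (\<integral>y. (\<integral>x. std_normal_density y * b y * kern y x \<partial>lborel) \<partial>lborel)"
    by (subst kern_symmetric) (simp add: mult_ac)
  also have "\<dots> = (\<integral>y. std_normal_density y * b y \<partial>lborel)"
    using r by (simp add: kern_def)
  finally show ?thesis .
qed

text \<open>Reflecting y, in which h is odd, replaces \<open>kern x y\<close> by its negative at -y;
  the mean of both integrands is half the one with \<open>folded\<close>. This half cancels the 2 in
  \<open>folded_moment\<close>, so the Schur test yields exactly the factor q.\<close>

lemma odd_bound:
  fixes h :: "real \<times> real \<Rightarrow> real"
  assumes [measurable]: "h \<in> borel_measurable (borel \<Otimes>\<^sub>M borel)" "a \<in> borel_measurable borel" "b \<in> borel_measurable borel"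
    and bd: "bounded (range h)" "bounded (range a)" "bounded (range b)"
    and odd: "\<And>x y. h (- x, y) = - h (x, y)" "\<And>x y. h (x, - y) = - h (x, y)"
    and even: "\<And>x. a (- x) = a x"
    and nonneg: "\<And>x. 0 \<le> a x" "\<And>x. 0 \<le> b x"
    and le: "\<And>x y c. 0 < c \<Longrightarrow> h (x, y) \<le> (c * a x + b y / c) / 2"
  shows "(\<integral>x. (\<integral>z. h (x, q * x + r * z) \<partial>std_gaussian) \<partial>std_gaussian) \<le>
    q * ((\<integral>x. std_normal_density x * a x \<partial>lborel) + (\<integral>x. std_normal_density x * b x \<partial>lborel)) / 2"
proof -
  let ?L = "lborel \<Otimes>\<^sub>M lborel :: (real \<times> real) measure"
  let ?e = "\<lambda>x y. std_normal_density x * kern x y * h (x, y)"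
  have int: "integrable ?L (\<lambda>(x, y). ?e x y)"
    by (intro integrable_joint bd) measurable
  have flip: "(\<integral>y. ?e x y \<partial>lborel) = (\<integral>y. - (std_normal_density x * kern x (- y) * h (x, y)) \<partial>lborel)" for x
    using lborel_integral_real_affine[of "-1" "?e x" 0] by (simp add: odd)
  have int2: "integrable ?L (\<lambda>(x, y). - (std_normal_density x * kern x (- y) * h (x, y)))"
  proof (rule lborel_pair.Fubini_integrable)
    show "AE x in lborel. integrable lborel (\<lambda>y. case (x, y) of (x, y) \<Rightarrow> - (std_normal_density x * kern x (- y) * h (x, y)))"
      using lborel_pair.AE_integrable_fst'[OF int]
    proof eventually_elim
      case (elim x)
      then show ?case
        using lborel_integrable_real_affine_iff[of "-1" "?e x" 0] by (simp add: odd)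
    qed
    have "integrable lborel (\<lambda>x. \<integral>y. norm (?e x y) \<partial>lborel)"
      using lborel_pair.integrable_fst'[OF integrable_norm[OF int]] by simp
    moreover have "(\<integral>y. norm (?e x y) \<partial>lborel) = (\<integral>y. norm (- (std_normal_density x * kern x (- y) * h (x, y))) \<partial>lborel)" for x
      using lborel_integral_real_affine[of "-1" "\<lambda>y. norm (?e x y)" 0] by (simp add: odd)
    ultimately show "integrable lborel (\<lambda>x. \<integral>y. norm (case (x, y) of (x, y) \<Rightarrow> - (std_normal_density x * kern x (- y) * h (x, y))) \<partial>lborel)"
      by simp
  qed measurable
  have swap: "integrable ?L (\<lambda>p. schur b (prod.swap p))"
    "(\<integral>p. schur b (prod.swap p) \<partial>?L) = integral\<^sup>L ?L (schur b)"
    using schur_integral[of b] bd nonneg lborel_pair.integrable_product_swap[of "schur b"]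
      lborel_pair.integral_product_swap[of "schur b"]
    by (auto simp: has_bochner_integral_iff prod.swap_def case_prod_beta')
  have "2 * (\<integral>(x, y). ?e x y \<partial>?L) = (\<integral>p. (case p of (x, y) \<Rightarrow> ?e x y) + (case p of (x, y) \<Rightarrow> - (std_normal_density x * kern x (- y) * h (x, y))) \<partial>?L)"
  proof -
    have "(\<integral>(x, y). ?e x y \<partial>?L) = (\<integral>(x, y). - (std_normal_density x * kern x (- y) * h (x, y)) \<partial>?L)"
      using lborel_pair.integral_fst'[OF int] lborel_pair.integral_fst'[OF int2] flip by simp
    then show ?thesis
      by (subst Bochner_Integration.integral_add[OF int int2]) simp
  qed
  also have "\<dots> = (\<integral>(x, y). std_normal_density x * folded x y * h (x, y) \<partial>?L)"
    by (intro Bochner_Integration.integral_cong refl) (auto simp: folded_def algebra_simps)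
  also have "\<dots> \<le> (\<integral>p. (schur a p + schur b (prod.swap p)) / 2 \<partial>?L)"
  proof (rule integral_mono)
    have "integrable ?L (\<lambda>p. (case p of (x, y) \<Rightarrow> ?e x y) + (case p of (x, y) \<Rightarrow> - (std_normal_density x * kern x (- y) * h (x, y))))"
      by (intro Bochner_Integration.integrable_add int int2)
    moreover have "(\<lambda>p. (case p of (x, y) \<Rightarrow> ?e x y) + (case p of (x, y) \<Rightarrow> - (std_normal_density x * kern x (- y) * h (x, y)))) =
      (\<lambda>(x, y). std_normal_density x * folded x y * h (x, y))"
      by (auto simp: folded_def algebra_simps)
    ultimately show "integrable ?L (\<lambda>(x, y). std_normal_density x * folded x y * h (x, y))" by simp
    show "integrable ?L (\<lambda>p. (schur a p + schur b (prod.swap p)) / 2)"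
      using schur_integral[of a] bd nonneg
      by (intro integrable_divide Bochner_Integration.integrable_add swap) (auto simp: has_bochner_integral_iff)
  qed (use schur_bound[of h a b] odd even nonneg le in \<open>auto simp: prod.swap_def\<close>)
  also have "\<dots> = (2 * q * (\<integral>x. std_normal_density x * a x \<partial>lborel) + 2 * q * (\<integral>x. std_normal_density x * b x \<partial>lborel)) / 2"
    using schur_integral[of a] schur_integral[of b] bd nonneg swap
    by (simp add: has_bochner_integral_iff)
  finally show ?thesis
    by (subst integral_joint) (use bd in \<open>simp_all add: algebra_simps\<close>)
qed

end


section \<open>A single coupling under either perturbation\<close>

fun perturb :: "perturbation \<Rightarrow> real \<Rightarrow> real \<times> real \<times> bool \<Rightarrow> real" where
  "perturb Continuous t (x, z, b) = exp (- t) * x + sqrt (1 - exp (- 2 * t)) * z"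
| "perturb Discrete t (x, z, b) = of_bool b * x + (1 - of_bool b) * z"

definition coupling_law :: "real \<Rightarrow> (real \<times> real \<times> bool) measure" where
  "coupling_law t = std_gaussian \<Otimes>\<^sub>M (std_gaussian \<Otimes>\<^sub>M measure_pmf (bernoulli_pmf (exp (- t))))"

lemma prob_space_std_gaussian: "prob_space std_gaussian"
  by (rule prob_space_normal_density) simp

lemma prob_space_coupling_law: "prob_space (coupling_law t)"
  unfolding coupling_law_def
  by (intro prob_space_pair prob_space_std_gaussian measure_pmf.prob_space_axioms)

lemma integral_coupling_law:
  fixes F :: "real \<times> real \<times> bool \<Rightarrow> real"
  assumes "F \<in> borel_measurable (coupling_law t)" "bounded (range F)" "0 \<le> t"
  shows "(\<integral>p. F p \<partial>coupling_law t) = (\<integral>x. (\<integral>z. exp (- t) * F (x, z, True) +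
    (1 - exp (- t)) * F (x, z, False) \<partial>std_gaussian) \<partial>std_gaussian)"
proof -
  interpret G: prob_space std_gaussian by (rule prob_space_std_gaussian)
  interpret B: prob_space "measure_pmf (bernoulli_pmf (exp (- t)))" by unfold_locales
  interpret GB: pair_prob_space std_gaussian "measure_pmf (bernoulli_pmf (exp (- t)))" by unfold_locales
  interpret GGB: pair_prob_space std_gaussian "std_gaussian \<Otimes>\<^sub>M measure_pmf (bernoulli_pmf (exp (- t)))"
    by unfold_locales
  note [measurable] = assms(1)[unfolded coupling_law_def]
  have "(\<integral>p. F p \<partial>coupling_law t) =
      (\<integral>x. (\<integral>p. F (x, p) \<partial>(std_gaussian \<Otimes>\<^sub>M measure_pmf (bernoulli_pmf (exp (- t))))) \<partial>std_gaussian)"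
    unfolding coupling_law_def
    by (intro GGB.integral_fst'[symmetric] GGB.P.integrable_bounded_range assms(2)) measurable
  also have "\<dots> = (\<integral>x. (\<integral>z. (\<integral>b. F (x, z, b) \<partial>measure_pmf (bernoulli_pmf (exp (- t)))) \<partial>std_gaussian) \<partial>std_gaussian)"
    by (intro Bochner_Integration.integral_cong refl GB.integral_fst'[symmetric] GB.P.integrable_bounded_range
        bounded_range_comp[OF assms(2)]) measurable
  finally show ?thesis
    using assms(3) by (simp add: mult.commute)
qed

lemma integral_std_gaussian_uminus:
  fixes f :: "real \<Rightarrow> real"
  assumes [measurable]: "f \<in> borel_measurable borel"
  shows "(\<integral>x. f (- x) \<partial>std_gaussian) = (\<integral>x. f x \<partial>std_gaussian)"
  using lborel_integral_real_affine[of "-1" "\<lambda>x. std_normal_density x * f x" 0]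
  by (simp add: integral_density std_normal_density_def)

lemma borel_measurable_perturb [measurable]: "perturb \<pi> t \<in> borel_measurable (coupling_law t)"
proof -
  have "perturb Continuous t = (\<lambda>p. exp (- t) * fst p + sqrt (1 - exp (- 2 * t)) * fst (snd p))"
    "perturb Discrete t = (\<lambda>p. if snd (snd p) then fst p else fst (snd p))"
    by (auto simp: fun_eq_iff)
  moreover have "(\<lambda>p. exp (- t) * fst p + sqrt (1 - exp (- 2 * t)) * fst (snd p)) \<in> borel_measurable (coupling_law t)"
    "(\<lambda>p. if snd (snd p) then fst p else fst (snd p)) \<in> borel_measurable (coupling_law t)"
    unfolding coupling_law_def by measurable
  ultimately show ?thesis by (cases \<pi>) simp_all
qed

lemma perturb_uminus: "perturb \<pi> t (- x, - z, b) = - perturb \<pi> t (x, z, b)"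
  by (cases \<pi>) auto

lemma borel_measurable_fst_coupling_law [measurable]: "fst \<in> borel_measurable (coupling_law t)"
  unfolding coupling_law_def by measurable

text \<open>A resampled coupling is independent of the old one, so there an odd h averages to 0 and
  only the diagonal remains, with weight exp(-t). In the Gaussian case the contraction is
  \<open>odd_bound\<close> with q = exp(-t), whose kernel has positive variance because t >
  0.\<close>

lemma noisy_pair_coupling_law:
  assumes t: "t > 0"
  shows "noisy_pair (coupling_law t) fst (perturb \<pi> t) (exp (- t))"
proof -
  interpret G: prob_space std_gaussian by (rule prob_space_std_gaussian)
  interpret prob_space "coupling_law t" by (rule prob_space_coupling_law)
  have [simp]: "G.prob UNIV = 1"
    using G.prob_space by simp
  show ?thesis
  proof
    fix h :: "real \<times> real \<Rightarrow> real"
    assume [measurable]: "h \<in> borel_measurable (borel \<Otimes>\<^sub>M borel)" and h: "bounded (range h)"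
    have m: "(\<lambda>(x, z). perturb \<pi> t (x, z, b)) \<in> borel_measurable (borel \<Otimes>\<^sub>M borel)" for b
      by (cases \<pi>) simp_all
    \<comment> \<open>The Bernoulli variable is averaged out. Changing the signs of x and z together
      changes both members of the pair, so the symmetry of the two Gaussians suffices.\<close>
    define k where "k x z = exp (- t) * h (x, perturb \<pi> t (x, z, True)) +
      (1 - exp (- t)) * h (x, perturb \<pi> t (x, z, False))" for x z
    have [measurable]: "(\<lambda>(x, z). k x z) \<in> borel_measurable (borel \<Otimes>\<^sub>M borel)"
      unfolding k_def using m[of True] m[of False] by measurable
    have eq: "(\<integral>w. h (s * fst w, s * perturb \<pi> t w) \<partial>coupling_law t) =
      (\<integral>x. (\<integral>z. k (s * x) (s * z) \<partial>std_gaussian) \<partial>std_gaussian)" if "s = 1 \<or> s = - 1" for s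
      using that t by (subst integral_coupling_law) (auto intro: bounded_range_comp[OF h] simp: k_def perturb_uminus)
    have "(\<integral>x. (\<integral>z. k (- x) (- z) \<partial>std_gaussian) \<partial>std_gaussian) =
      (\<integral>x. (\<integral>z. k (- x) z \<partial>std_gaussian) \<partial>std_gaussian)"
      by (subst integral_std_gaussian_uminus[of "k _"]) auto
    also have "\<dots> = (\<integral>x. (\<integral>z. k x z \<partial>std_gaussian) \<partial>std_gaussian)"
      by (rule integral_std_gaussian_uminus) measurable
    finally show "(\<integral>w. h (- fst w, - perturb \<pi> t w) \<partial>coupling_law t) = (\<integral>w. h (fst w, perturb \<pi> t w) \<partial>coupling_law t)"
      using eq[of "-1"] eq[of 1] by simp
  next
    fix h :: "real \<times> real \<Rightarrow> real" and a b :: "real \<Rightarrow> real"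
    assume [measurable]: "h \<in> borel_measurable (borel \<Otimes>\<^sub>M borel)" "a \<in> borel_measurable borel" "b \<in> borel_measurable borel"
      and bd: "bounded (range h)" "bounded (range a)" "bounded (range b)"
      and odd: "\<And>x y. h (- x, y) = - h (x, y)" "\<And>x y. h (x, - y) = - h (x, y)"
      and even: "\<And>x. a (- x) = a x"
      and nonneg: "\<And>x. 0 \<le> a x" "\<And>x. 0 \<le> b x"
      and le: "\<And>x y c. 0 < c \<Longrightarrow> h (x, y) \<le> (c * a x + b y / c) / 2"
    have int: "integrable std_gaussian f" if "f \<in> borel_measurable borel" "bounded (range f)" for f :: "real \<Rightarrow> real"
      using that by (intro G.integrable_bounded_range) auto
    have fst_a: "(\<integral>w. a (fst w) \<partial>coupling_law t) = (\<integral>x. a x \<partial>std_gaussian)"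
      using t G.prob_space
      by (subst integral_coupling_law) (auto intro: bounded_range_comp[OF bd(2)] simp: algebra_simps)
    show "(\<integral>w. h (fst w, perturb \<pi> t w) \<partial>coupling_law t) \<le>
      exp (- t) * ((\<integral>w. a (fst w) \<partial>coupling_law t) + (\<integral>w. b (perturb \<pi> t w) \<partial>coupling_law t)) / 2"
    proof (cases \<pi>)
      case Continuous
      define r where "r = sqrt (1 - exp (- 2 * t))"
      have r: "r\<^sup>2 = 1 - exp (- 2 * t)" "0 < r"
        using t by (simp_all add: r_def)
      interpret C: gaussian_pair "exp (- t)" r
        using r by unfold_locales (auto simp flip: exp_double)
      have "(\<integral>w. h (fst w, perturb \<pi> t w) \<partial>coupling_law t) =
        (\<integral>x. (\<integral>z. h (x, exp (- t) * x + r * z) \<partial>std_gaussian) \<partial>std_gaussian)"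
        using t by (subst integral_coupling_law)
          (auto intro: bounded_range_comp[OF bd(1)] simp: Continuous r_def algebra_simps)
      also have "\<dots> \<le> exp (- t) * ((\<integral>x. std_normal_density x * a x \<partial>lborel) + (\<integral>x. std_normal_density x * b x \<partial>lborel)) / 2"
        by (rule C.odd_bound) (measurable, measurable, measurable, (fact bd odd even nonneg le)+)
      also have "(\<integral>x. std_normal_density x * b x \<partial>lborel) = (\<integral>w. b (perturb \<pi> t w) \<partial>coupling_law t)"
        using t C.integral_snd_joint[of b] bd by (subst integral_coupling_law)
          (auto intro: bounded_range_comp[OF bd(3)] simp: Continuous r_def algebra_simps)
      also have "(\<integral>x. std_normal_density x * a x \<partial>lborel) = (\<integral>w. a (fst w) \<partial>coupling_law t)"
        unfolding fst_a by (subst integral_density) auto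
      finally show ?thesis .
    next
      case Discrete
      have zero: "(\<integral>z. h (x, z) \<partial>std_gaussian) = 0" for x
        using integral_std_gaussian_uminus[of "\<lambda>z. h (x, z)"] by (simp add: odd)
      have "(\<integral>w. h (fst w, perturb \<pi> t w) \<partial>coupling_law t) =
        (\<integral>x. (\<integral>z. exp (- t) * h (x, x) + (1 - exp (- t)) * h (x, z) \<partial>std_gaussian) \<partial>std_gaussian)"
        using t by (subst integral_coupling_law) (auto intro: bounded_range_comp[OF bd(1)] simp: Discrete)
      also have "\<dots> = exp (- t) * (\<integral>x. h (x, x) \<partial>std_gaussian)"
      proof -
        have "(\<integral>z. exp (- t) * h (x, x) + (1 - exp (- t)) * h (x, z) \<partial>std_gaussian) = exp (- t) * h (x, x)" for x
          by (subst Bochner_Integration.integral_add)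
            (auto intro!: int bounded_range_comp[OF bd(1)] simp: zero)
        then show ?thesis by simp
      qed
      \<comment> \<open>On the diagonal the linearised bound is used with c = 1.\<close>
      also have "\<dots> \<le> exp (- t) * (\<integral>x. (a x + b x) / 2 \<partial>std_gaussian)"
        using le[of 1] by (intro mult_left_mono integral_mono integrable_divide Bochner_Integration.integrable_add int
            bounded_range_comp[OF bd(1)] bd) auto
      also have "\<dots> = exp (- t) * ((\<integral>x. a x \<partial>std_gaussian) + (\<integral>x. b x \<partial>std_gaussian)) / 2"
        by (subst Bochner_Integration.integral_add[symmetric]) (auto intro!: int bd)
      \<comment> \<open>The old and the fresh coupling have the same law, so mixing them preserves
        the mean of b.\<close>
      also have "(\<integral>x. b x \<partial>std_gaussian) = (\<integral>w. b (perturb \<pi> t w) \<partial>coupling_law t)"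
      proof -
        have "(\<integral>w. b (perturb \<pi> t w) \<partial>coupling_law t) =
          (\<integral>x. (\<integral>z. exp (- t) * b x + (1 - exp (- t)) * b z \<partial>std_gaussian) \<partial>std_gaussian)"
          using t by (subst integral_coupling_law) (auto intro: bounded_range_comp[OF bd(3)] simp: Discrete)
        also have "\<dots> = (\<integral>x. exp (- t) * b x + (1 - exp (- t)) * (\<integral>z. b z \<partial>std_gaussian) \<partial>std_gaussian)"
        proof (rule Bochner_Integration.integral_cong[OF refl])
          show "(\<integral>z. exp (- t) * b x + (1 - exp (- t)) * b z \<partial>std_gaussian) =
            exp (- t) * b x + (1 - exp (- t)) * (\<integral>z. b z \<partial>std_gaussian)" for x
            by (subst Bochner_Integration.integral_add) (auto intro!: int bd)
        qed
        also have "\<dots> = (\<integral>z. b z \<partial>std_gaussian)"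
          by (subst Bochner_Integration.integral_add) (auto intro!: int bd simp: algebra_simps)
        finally show ?thesis ..
      qed
      finally show ?thesis unfolding fst_a .
    qed
  qed (auto intro: borel_measurable_perturb)
qed

subsection \<open>Gauge symmetry and closing walks\<close>

lemma minus_one_power_card_sym_diff:
  fixes X Y :: "'a set"
  assumes "finite X" "finite Y"
  shows "(- 1 :: real) ^ card (sym_diff X Y) = (- 1) ^ card X * (- 1) ^ card Y"
proof -
  have "card X = card (X - Y) + card (X \<inter> Y)" and "card Y = card (Y - X) + card (X \<inter> Y)"
    and "card (sym_diff X Y) = card (X - Y) + card (Y - X)"
    using assms by (simp_all add: card_Diff_subset_Int card_mono card_Un_disjoint Int_commute Diff_Int_distrib2 Diff_triv
        disjoint_iff)
  then show ?thesis by (simp add: power_add mult_ac flip: power_mult_distrib)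
qed

text \<open>Symmetric difference with \<open>G\<close> permutes \<open>Pow I\<close> and multiplies
  every term by the same sign. A class \<open>A\<close> for which this sign is -1 therefore cannot
  occur in \<open>f\<close>.\<close>

lemma walsh_gauge:
  assumes "finite I" "G \<subseteq> I" "\<And>x. f (flip G x) = s * f x"
  shows "walsh I A f x = s * (- 1) ^ card (G \<inter> A) * walsh I A f x"
proof -
  have fin: "finite U" if "U \<subseteq> I" for U
    using assms(1) that finite_subset by blast
  have bij: "bij_betw (\<lambda>U. sym_diff U G) (Pow I) (Pow I)"
    by (rule bij_betw_byWitness[where f' = "\<lambda>U. sym_diff U G"]) (use assms(2) in auto)
  have "walsh I A f x = (\<Sum>U\<in>Pow I. (- 1) ^ card (sym_diff U G \<inter> A) * f (flip (sym_diff U G) x))"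
    unfolding walsh_def by (rule sum.reindex_bij_betw[OF bij, symmetric])
  also have "\<dots> = (\<Sum>U\<in>Pow I. s * (- 1) ^ card (G \<inter> A) * ((- 1) ^ card (U \<inter> A) * f (flip U x)))"
  proof (intro sum.cong refl)
    fix U assume U: "U \<in> Pow I"
    have "flip (sym_diff U G) x = flip G (flip U x)"
      by (auto simp: flip_def fun_eq_iff)
    moreover have "sym_diff U G \<inter> A = sym_diff (U \<inter> A) (G \<inter> A)" by auto
    ultimately show "(- 1) ^ card (sym_diff U G \<inter> A) * f (flip (sym_diff U G) x) =
        s * (- 1) ^ card (G \<inter> A) * ((- 1) ^ card (U \<inter> A) * f (flip U x))"
      using U assms(2) fin by (simp add: assms(3) minus_one_power_card_sym_diff)
  qed
  also have "\<dots> = s * (- 1) ^ card (G \<inter> A) * walsh I A f x"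
    by (simp only: walsh_def sum_distrib_left)
  finally show ?thesis .
qed

text \<open>One unnormalised weight for all temperatures: at infinity it is the indicator of the
  ground states, whose normalisation is their uniform measure. Being written through energies only,
  it is carried along by spin flips and is measurable in the couplings.\<close>

definition gibbs_weight :: "nat \<Rightarrow> ennreal \<Rightarrow> ((nat \<Rightarrow> real) \<Rightarrow> real) \<Rightarrow> (nat \<Rightarrow> real) \<Rightarrow> real" where
  "gibbs_weight N \<beta> H \<sigma> =
    (if \<beta> = \<infinity> then of_bool (\<forall>\<tau>\<in>configs N. H \<tau> \<le> H \<sigma>) else exp (enn2real \<beta> * H \<sigma>))"

lemma gibbs_expectation:
  "measure_pmf.expectation (gibbs N \<beta> H) f =
    (\<Sum>\<sigma>\<in>configs N. f \<sigma> * gibbs_weight N \<beta> H \<sigma>) / (\<Sum>\<sigma>\<in>configs N. gibbs_weight N \<beta> H \<sigma>)"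
  for f :: "(nat \<Rightarrow> real) \<Rightarrow> real"
proof (cases "\<beta> = \<infinity>")
  case True
  define A where "A = {\<sigma>. is_arg_max H (\<lambda>\<sigma>. \<sigma> \<in> configs N) \<sigma>}"
  have A: "A = {\<sigma> \<in> configs N. \<forall>\<tau>\<in>configs N. H \<tau> \<le> H \<sigma>}"
    by (auto simp: A_def is_arg_max_linorder)
  have "A \<noteq> {}"
    using set_pmf_not_empty[of "gibbs N \<infinity> H"] unfolding set_pmf_gibbs_infinite A_def .
  moreover have "finite A"
    by (simp add: A finite_configs)
  ultimately have "measure_pmf.expectation (gibbs N \<beta> H) f = sum f A / card A"
    by (simp add: gibbs_def True A_def[symmetric] integral_pmf_of_set)
  also have "\<dots> = (\<Sum>\<sigma>\<in>configs N. f \<sigma> * gibbs_weight N \<beta> H \<sigma>) / (\<Sum>\<sigma>\<in>configs N. gibbs_weight N \<beta> H \<sigma>)"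
  proof -
    have "sum g A = (\<Sum>\<sigma>\<in>configs N. g \<sigma> * gibbs_weight N \<beta> H \<sigma>)" for g :: "_ \<Rightarrow> real"
      unfolding A sum.inter_filter[OF finite_configs]
      by (intro sum.cong refl) (simp add: gibbs_weight_def True)
    from this[of f] this[of "\<lambda>_. 1"] show ?thesis by simp
  qed
  finally show ?thesis .
next
  case False
  then have "measure_pmf.expectation (gibbs N \<beta> H) f = (\<Sum>\<sigma>\<in>configs N. f \<sigma> * pmf (gibbs N \<beta> H) \<sigma>)"
    by (intro integral_measure_pmf_real finite_configs) (auto simp: set_pmf_iff pmf_gibbs_finite split: if_splits)
  with False show ?thesis
    by (simp add: pmf_gibbs_finite gibbs_weight_def sum_divide_distrib)
qed

definition correlation :: "nat \<Rightarrow> (nat \<Rightarrow> real \<Rightarrow> real) \<Rightarrow> nat \<Rightarrow> ennreal \<Rightarrow> (nat set \<Rightarrow> bool) \<Rightarrow>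
    nat \<Rightarrow> nat \<Rightarrow> (nat set \<Rightarrow> real) \<Rightarrow> real" where
  "correlation \<Delta> \<rho> N \<beta> S i j J =
    measure_pmf.expectation (gibbs N \<beta> (hamiltonian \<Delta> \<rho> N S J)) (\<lambda>\<sigma>. \<sigma> i * \<sigma> j)"

lemma set_pmf_gibbs: "set_pmf (gibbs N \<beta> H) \<subseteq> configs N"
proof (cases "\<beta> = \<infinity>")
  case True
  show ?thesis unfolding True set_pmf_gibbs_infinite by (auto simp: is_arg_max_def)
next
  case False
  then show ?thesis by (auto simp: set_pmf_iff pmf_gibbs_finite split: if_splits)
qed

lemma config_abs: "\<sigma> \<in> configs N \<Longrightarrow> i \<in> {1..N} \<Longrightarrow> \<bar>\<sigma> i\<bar> = 1"
  unfolding configs_def by (drule (1) PiE_mem) auto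

lemma correlation_bounded:
  assumes "i \<in> {1..N}" "j \<in> {1..N}"
  shows "\<bar>correlation \<Delta> \<rho> N \<beta> S i j J\<bar> \<le> 1"
proof -
  let ?g = "gibbs N \<beta> (hamiltonian \<Delta> \<rho> N S J)"
  have "AE \<sigma> in measure_pmf ?g. \<bar>\<sigma> i * \<sigma> j\<bar> \<le> 1"
    using set_pmf_gibbs config_abs[OF _ assms(1)] config_abs[OF _ assms(2)]
    by (fastforce simp: AE_measure_pmf_iff abs_mult)
  moreover from this have "integrable (measure_pmf ?g) (\<lambda>\<sigma>. \<sigma> i * \<sigma> j)"
    by (intro measure_pmf.integrable_const_bound) auto
  ultimately have "(\<integral>\<sigma>. \<bar>\<sigma> i * \<sigma> j\<bar> \<partial>measure_pmf ?g) \<le> (\<integral>\<sigma>. 1 \<partial>measure_pmf ?g)"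
    by (intro integral_mono_AE) auto
  then show ?thesis
    unfolding correlation_def by (intro order_trans[OF integral_abs_bound]) simp
qed

lemma hamiltonian_flip_vertex:
  assumes \<rho>: "\<forall>p\<in>{2..\<Delta>}. \<forall>x. \<rho> p (- x) = - \<rho> p x"
  shows "hamiltonian \<Delta> \<rho> N S (flip {e \<in> potential_edges \<Delta> N. v \<in> e} J) \<sigma> =
    hamiltonian \<Delta> \<rho> N S J (\<sigma>(v := - \<sigma> v))"
  unfolding hamiltonian_def
proof (intro sum.cong refl)
  fix p e assume p: "p \<in> {2..\<Delta>}" and e: "e \<in> edges N S p"
  then have e': "e \<subseteq> {1..N}" "card e = p" by (auto simp: edges_def)
  then have fin: "finite e" using finite_subset by blast
  have pe: "e \<in> potential_edges \<Delta> N" using p e' by (simp add: potential_edges_def)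
  show "\<rho> p (flip {e \<in> potential_edges \<Delta> N. v \<in> e} J e) * (\<Prod>i\<in>e. \<sigma> i) =
    \<rho> p (J e) * (\<Prod>i\<in>e. (\<sigma>(v := - \<sigma> v)) i)"
  proof (cases "v \<in> e")
    case True
    have "(\<Prod>i\<in>e - {v}. (\<sigma>(v := - \<sigma> v)) i) = (\<Prod>i\<in>e - {v}. \<sigma> i)"
      by (intro prod.cong) auto
    then show ?thesis
      using True pe fin by (simp add: flip_def \<rho>[rule_format, OF p] prod.remove[OF fin True])
  next
    case False
    then have "(\<Prod>i\<in>e. (\<sigma>(v := - \<sigma> v)) i) = (\<Prod>i\<in>e. \<sigma> i)"
      by (intro prod.cong) auto
    with False show ?thesis by (simp add: flip_def)
  qed
qed

lemma hamiltonian_flip_unselected: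
  assumes "\<not> S e"
  shows "hamiltonian \<Delta> \<rho> N S (flip {e} J) = hamiltonian \<Delta> \<rho> N S J"
  unfolding hamiltonian_def using assms
  by (intro ext sum.cong refl) (auto simp: edges_def flip_def)

lemma bij_betw_spin_flip:
  assumes "v \<in> {1..N}"
  shows "bij_betw (\<lambda>\<sigma>. \<sigma>(v := - \<sigma> v)) (configs N) (configs N)"
proof -
  have "\<sigma>(v := - \<sigma> v) \<in> configs N" if "\<sigma> \<in> configs N" for \<sigma>
    unfolding configs_def
  proof (rule PiE_I)
    note \<sigma> = that[unfolded configs_def]
    show "(\<sigma>(v := - \<sigma> v)) x \<in> {- 1, 1}" if "x \<in> {1..N}" for x
      using PiE_mem[OF \<sigma> that] PiE_mem[OF \<sigma> assms] by auto
    show "(\<sigma>(v := - \<sigma> v)) x = undefined" if "x \<notin> {1..N}" for x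
      using PiE_arb[OF \<sigma> that] that assms by auto
  qed
  then show ?thesis
    by (intro bij_betw_byWitness[where f' = "\<lambda>\<sigma>. \<sigma>(v := - \<sigma> v)"]) auto
qed

text \<open>The spin flip permutes the configurations and carries the weights along, ground states
  included, so both sums can be reindexed. As \<open>i\<close> and \<open>j\<close> differ, flipping
  at one of them changes exactly one factor of the product of the two spins.\<close>

lemma correlation_flip_vertex:
  assumes \<rho>: "\<forall>p\<in>{2..\<Delta>}. \<forall>x. \<rho> p (- x) = - \<rho> p x"
    and v: "v \<in> {1..N}" and "i \<noteq> j"
  shows "correlation \<Delta> \<rho> N \<beta> S i j (flip {e \<in> potential_edges \<Delta> N. v \<in> e} J) =
    (if v \<in> {i, j} then - 1 else 1) * correlation \<Delta> \<rho> N \<beta> S i j J"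
proof -
  let ?T = "\<lambda>\<sigma> :: nat \<Rightarrow> real. \<sigma>(v := - \<sigma> v)"
  let ?H = "hamiltonian \<Delta> \<rho> N S J" and ?H' = "hamiltonian \<Delta> \<rho> N S (flip {e \<in> potential_edges \<Delta> N. v \<in> e} J)"
  note bij = bij_betw_spin_flip[OF v]
  have H: "?H' \<sigma> = ?H (?T \<sigma>)" for \<sigma>
    by (rule hamiltonian_flip_vertex[OF \<rho>])
  have "(\<forall>\<tau>\<in>configs N. ?H (?T \<tau>) \<le> c) \<longleftrightarrow> (\<forall>\<tau>\<in>configs N. ?H \<tau> \<le> c)" for c
    using bij_betw_imp_surj_on[OF bij] by (metis (mono_tags, lifting) image_iff)
  then have wt: "gibbs_weight N \<beta> ?H' \<sigma> = gibbs_weight N \<beta> ?H (?T \<sigma>)" for \<sigma>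
    by (simp add: gibbs_weight_def H)
  have s: "\<sigma> i * \<sigma> j = (if v \<in> {i, j} then - 1 else 1) * (?T \<sigma> i * ?T \<sigma> j)" for \<sigma> :: "nat \<Rightarrow> real"
    using \<open>i \<noteq> j\<close> by auto
  show ?thesis
    unfolding correlation_def gibbs_expectation wt
    unfolding sum.reindex_bij_betw[OF bij, of "gibbs_weight N \<beta> ?H"]
    by (subst s, simp only: mult.assoc sum_distrib_left[symmetric] times_divide_eq_right[symmetric],
      subst sum.reindex_bij_betw[OF bij, of "\<lambda>\<sigma>. \<sigma> i * (\<sigma> j * gibbs_weight N \<beta> ?H \<sigma>)"], simp)
qed

lemma finite_potential_edges: "finite (potential_edges \<Delta> N)"
  by (rule finite_subset[of _ "Pow {1..N}"]) (auto simp: potential_edges_def)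

lemma finite_potential_edge: "e \<in> potential_edges \<Delta> N \<Longrightarrow> finite e"
  using finite_subset by (auto simp: potential_edges_def)

text \<open>Both claims are the sign rule of \<open>walsh_gauge\<close>: with \<open>G\<close> a
  single unselected edge, which the Hamiltonian does not see, and with \<open>G\<close> the star of
  \<open>v\<close>.\<close>

lemma walsh_correlation_nonzero:
  assumes \<rho>: "\<forall>p\<in>{2..\<Delta>}. \<forall>x. \<rho> p (- x) = - \<rho> p x"
    and ij: "i \<noteq> j" and A: "A \<subseteq> potential_edges \<Delta> N"
    and nz: "walsh (potential_edges \<Delta> N) A (correlation \<Delta> \<rho> N \<beta> S i j) x \<noteq> 0"
  shows "e \<in> A \<Longrightarrow> S e" and "v \<in> {1..N} \<Longrightarrow> odd (card {e \<in> A. v \<in> e}) \<longleftrightarrow> v \<in> {i, j}"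
proof -
  note gauge = walsh_gauge[OF finite_potential_edges[of \<Delta> N], where f = "correlation \<Delta> \<rho> N \<beta> S i j" and A = A and x = x]
  show "S e" if e: "e \<in> A"
  proof (rule ccontr)
    assume "\<not> S e"
    then have "correlation \<Delta> \<rho> N \<beta> S i j (flip {e} J) = 1 * correlation \<Delta> \<rho> N \<beta> S i j J" for J
      by (simp add: correlation_def hamiltonian_flip_unselected)
    from gauge[OF _ this] e A nz show False by auto
  qed
  show "odd (card {e \<in> A. v \<in> e}) \<longleftrightarrow> v \<in> {i, j}" if v: "v \<in> {1..N}"
  proof -
    have "{e \<in> potential_edges \<Delta> N. v \<in> e} \<inter> A = {e \<in> A. v \<in> e}"
      using A by auto
    with gauge[OF _ correlation_flip_vertex[OF \<rho> v ij]] nz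
    have "(if v \<in> {i, j} then - 1 else 1) * (- 1 :: real) ^ card {e \<in> A. v \<in> e} = 1"
      by simp
    then show ?thesis
      by (cases "even (card {e \<in> A. v \<in> e})") (auto split: if_splits)
  qed
qed

text \<open>The walks counted have \<open>m + 1\<close> edges; \<open>F\<close> accumulates the edges already used and \<open>D\<close>
  the vertices on which the walk may end.\<close>

primrec closing_walks :: "nat set set \<Rightarrow> (nat set \<Rightarrow> bool) \<Rightarrow> nat \<Rightarrow> nat \<Rightarrow> nat set \<Rightarrow> nat set set \<Rightarrow> real" where
  "closing_walks I S 0 v D F =
    (\<Sum>e | e \<in> I \<and> v \<in> e \<and> e \<notin> F. \<Sum>w\<in>(e - {v}) \<inter> D. of_bool (S e))"
| "closing_walks I S (Suc m) v D F =
    (\<Sum>e | e \<in> I \<and> v \<in> e \<and> e \<notin> F. \<Sum>w\<in>e - {v}. of_bool (S e) * closing_walks I S m w (D \<union> e) (insert e F))"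

lemma closing_walks_nonneg: "0 \<le> closing_walks I S m v D F"
  by (induction m arbitrary: v D F) (auto intro!: sum_nonneg)

text \<open>Outside \<open>T\<close> every vertex meets an even number of edges of \<open>A\<close>, so a walk that enters a new
  vertex can always leave it through an unused edge of \<open>A\<close>.\<close>

lemma closing_walk_exists:
  assumes I: "finite I" "\<And>e. e \<in> I \<Longrightarrow> finite e"
    and A: "A \<subseteq> I" "\<And>e. e \<in> A \<Longrightarrow> S e" "\<And>e. e \<in> A \<Longrightarrow> 2 \<le> card e"
    and even: "\<And>v. v \<in> \<Union>A \<Longrightarrow> v \<notin> T \<Longrightarrow> even (card {e \<in> A. v \<in> e})"
    and "T \<subseteq> D" "F \<subseteq> A" "\<Union>F \<subseteq> D" "e \<in> A - F" "v \<in> e"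
  shows "\<exists>m<card (A - F). 1 \<le> closing_walks I S m v D F"
  using assms(7-)
proof (induction "card (A - F)" arbitrary: v D F e rule: less_induct)
  case less
  have finA: "finite A" using A(1) I(1) finite_subset by blast
  have e: "e \<in> I" "S e" "finite e" "2 \<le> card e" "e \<notin> F" "e \<in> A"
    using less.prems A I by auto
  have pos: "0 < card (A - F)"
    using less.prems finA by (auto simp: card_gt_0_iff)
  have fin: "finite {e. e \<in> I \<and> v \<in> e \<and> e \<notin> F}" using I(1) by simp
  have "e - {v} \<noteq> {}"
    using e(3,4) less.prems(5) by (metis Diff_eq_empty_iff card.empty card_insert_disjoint card_mono finite.intros One_nat_def Suc_1 empty_iff not_less_eq_eq)
  then obtain w where w: "w \<in> e - {v}" by blast
  show ?case
  proof (cases "w \<in> D")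
    case True
    have "1 \<le> real (card ((e - {v}) \<inter> D))"
      using True w e(3) by (auto simp: Suc_le_eq card_gt_0_iff)
    also have "\<dots> = (\<Sum>w\<in>(e - {v}) \<inter> D. of_bool (S e))"
      using e by simp
    also have "\<dots> \<le> closing_walks I S 0 v D F"
      unfolding closing_walks.simps
      using e less.prems by (intro member_le_sum[OF _ _ fin]) (auto intro!: sum_nonneg)
    finally show ?thesis using pos by blast
  next
    case False
    have "w \<in> \<Union>A" "w \<notin> T" using w e False less.prems by auto
    then have "even (card {e \<in> A. w \<in> e})" by (rule even)
    moreover have "e \<in> {e \<in> A. w \<in> e}" using w e by auto
    ultimately have "{e \<in> A. w \<in> e} \<noteq> {e}" by auto
    then obtain e' where e': "e' \<in> A" "w \<in> e'" "e' \<noteq> e"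
      using \<open>e \<in> {e \<in> A. w \<in> e}\<close> by blast
    \<comment> \<open>The edges already used lie inside \<open>D\<close>, and \<open>w\<close> does
      not.\<close>
    have "e' \<notin> F" using e'(2) False less.prems by auto
    have sub: "A - insert e F \<subset> A - F" using e by auto
    have "card (A - insert e F) < card (A - F)"
      using sub finA by (intro psubset_card_mono) auto
    moreover have "\<exists>m<card (A - insert e F). 1 \<le> closing_walks I S m w (D \<union> e) (insert e F)"
      using less.prems e e' \<open>e' \<notin> F\<close> calculation by (intro less.hyps[where e = e']) auto
    ultimately obtain m where m: "Suc m < card (A - F)" "1 \<le> closing_walks I S m w (D \<union> e) (insert e F)"
      by (meson less_trans_Suc)
    note m(2)
    also have "closing_walks I S m w (D \<union> e) (insert e F) \<le>
        (\<Sum>w\<in>e - {v}. of_bool (S e) * closing_walks I S m w (D \<union> e) (insert e F))"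
      using w e by (intro order_trans[OF _ member_le_sum[where i = w]]) (auto simp: closing_walks_nonneg)
    also have "\<dots> \<le> closing_walks I S (Suc m) v D F"
      unfolding closing_walks.simps
      using e less.prems
      by (intro member_le_sum[OF _ _ fin, where f = "\<lambda>e. \<Sum>w\<in>e - {v}. of_bool (S e) * closing_walks I S m w (D \<union> e) (insert e F)"])
        (auto intro!: sum_nonneg simp: closing_walks_nonneg)
    finally show ?thesis using m(1) by blast
  qed
qed

text \<open>A surviving class with at most \<open>K\<close> edges has odd degree at
  \<open>i\<close>, which supplies a first edge, and even degree away from \<open>i\<close> and
  \<open>j\<close>. It would contain a closing walk of at most \<open>K\<close> edges and push the
  sum up to 1.\<close>

lemma high_degree_correlation:
  assumes \<rho>: "\<forall>p\<in>{2..\<Delta>}. \<forall>x. \<rho> p (- x) = - \<rho> p x"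
    and ij: "i \<in> {1..N}" "j \<in> {1..N}" "i \<noteq> j"
    and none: "(\<Sum>m<K. closing_walks (potential_edges \<Delta> N) S m i {i, j} {}) < 1"
  shows "high_degree (Suc K) (potential_edges \<Delta> N) (correlation \<Delta> \<rho> N \<beta> S i j)"
  unfolding high_degree_def
proof (intro allI impI, rule ccontr)
  let ?I = "potential_edges \<Delta> N"
  fix A x assume A: "A \<subseteq> ?I" "card A < Suc K"
    and nz: "walsh ?I A (correlation \<Delta> \<rho> N \<beta> S i j) x \<noteq> 0"
  note sel = walsh_correlation_nonzero(1)[OF \<rho> ij(3) A(1) nz]
  note deg = walsh_correlation_nonzero(2)[OF \<rho> ij(3) A(1) nz]
  have "odd (card {e \<in> A. i \<in> e})" using deg[OF ij(1)] by simp
  then have "{e \<in> A. i \<in> e} \<noteq> {}" by (metis card.empty even_zero)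
  then obtain e where e: "e \<in> A" "i \<in> e" by blast
  have "\<exists>m<card (A - {}). 1 \<le> closing_walks ?I S m i {i, j} {}"
  proof (rule closing_walk_exists[where A = A and T = "{i, j}" and e = e])
    show "even (card {e \<in> A. v \<in> e})" if "v \<in> \<Union>A" "v \<notin> {i, j}" for v
    proof -
      have "v \<in> {1..N}" using that(1) A(1) by (fastforce simp: potential_edges_def)
      from deg[OF this] that(2) show ?thesis by simp
    qed
    show "2 \<le> card e" if "e \<in> A" for e
      using that A(1) by (auto simp: potential_edges_def)
  qed (use A e in \<open>auto intro: finite_potential_edges finite_potential_edge sel\<close>)
  then obtain m where m: "m < card A" "1 \<le> closing_walks ?I S m i {i, j} {}"
    by auto
  then have "m < K" using A(2) by simp
  note m(2)
  also have "closing_walks ?I S m i {i, j} {} \<le> (\<Sum>m<K. closing_walks ?I S m i {i, j} {})"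
    using \<open>m < K\<close> by (intro member_le_sum) (auto simp: closing_walks_nonneg)
  finally show False using none by simp
qed

subsection \<open>The expected number of closing walks\<close>

text \<open>From any vertex the expected number of choices of an edge and a next vertex is at most
  \<open>L\<close>; the last step has at most card \<open>D\<close> + m \<open>\<Delta>\<close>
  targets, each of expected weight at most \<open>c\<close>. The indicators of the edges in
  \<open>F\<close> are carried along as a factor, because a step of the walk is independent of the
  past only in the sense of products over distinct edges.\<close>

lemma closing_walks_expectation:
  fixes M :: "(nat set \<Rightarrow> bool) measure"
  assumes I: "finite I" "finite V" "\<And>e. e \<in> I \<Longrightarrow> e \<subseteq> V" "\<And>e. e \<in> I \<Longrightarrow> card e \<le> \<Delta>"
    and c: "\<And>v w. v \<in> V \<Longrightarrow> w \<in> V \<Longrightarrow> v \<noteq> w \<Longrightarrow> (\<Sum>e | e \<in> I \<and> v \<in> e \<and> w \<in> e. p e) \<le> c" "0 \<le> c"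
    and p: "\<And>e. e \<in> I \<Longrightarrow> 0 \<le> p e"
    and prod: "\<And>F. F \<subseteq> I \<Longrightarrow> has_bochner_integral M (\<lambda>S. \<Prod>e\<in>F. of_bool (S e)) (\<Prod>e\<in>F. p e)"
    and vDF: "v \<in> V" "D \<subseteq> V" "F \<subseteq> I"
  defines "L \<equiv> (real (card V) - 1) * c"
  shows "integrable M (\<lambda>S. (\<Prod>e\<in>F. of_bool (S e)) * closing_walks I S m v D F)"
    and "(\<integral>S. (\<Prod>e\<in>F. of_bool (S e)) * closing_walks I S m v D F \<partial>M) \<le>
      (\<Prod>e\<in>F. p e) * ((real (card D) + real m * real \<Delta>) * c * L ^ m)"
proof -
  \<comment> \<open>Exchanging the sums groups the choices by the next vertex \<open>w\<close>, for
    which \<open>c\<close> is the bound.\<close>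
  have inner: "(\<Sum>e | e \<in> I \<and> v \<in> e. \<Sum>w\<in>(e - {v}) \<inter> W. p e) \<le> real (card (W - {v})) * c"
    if "v \<in> V" "W \<subseteq> V" for v W
  proof -
    have "(\<Sum>e | e \<in> I \<and> v \<in> e. \<Sum>w\<in>(e - {v}) \<inter> W. p e) =
        (\<Sum>e | e \<in> I \<and> v \<in> e. \<Sum>w | w \<in> W - {v} \<and> w \<in> e. p e)"
      by (intro sum.cong refl) auto
    also have "\<dots> = (\<Sum>w\<in>W - {v}. \<Sum>e | e \<in> {e \<in> I. v \<in> e} \<and> w \<in> e. p e)"
      using I(1) finite_subset[OF that(2) I(2)] by (intro sum.swap_restrict) auto
    also have "\<dots> = (\<Sum>w\<in>W - {v}. \<Sum>e | e \<in> I \<and> v \<in> e \<and> w \<in> e. p e)"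
      by (simp add: conj_assoc)
    also have "\<dots> \<le> (\<Sum>w\<in>W - {v}. c)"
      using that by (intro sum_mono c) auto
    finally show ?thesis by simp
  qed
  have L: "(\<Sum>e | e \<in> I \<and> v \<in> e. \<Sum>w\<in>e - {v}. p e) \<le> L" if v: "v \<in> V" for v
  proof -
    have "(\<Sum>e | e \<in> I \<and> v \<in> e. \<Sum>w\<in>e - {v}. p e) = (\<Sum>e | e \<in> I \<and> v \<in> e. \<Sum>w\<in>(e - {v}) \<inter> V. p e)"
      using I(3) by (intro sum.cong refl) auto
    also have "\<dots> \<le> real (card (V - {v})) * c"
      using v by (intro inner) auto
    also have "\<dots> = L"
      using v I(2) card_gt_0_iff[of V] by (auto simp: L_def)
    finally show ?thesis .
  qed
  have L0: "0 \<le> L"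
    using c(2) vDF(1) I(2) card_gt_0_iff[of V] by (auto simp: L_def Suc_le_eq)
  have pF: "0 \<le> (\<Prod>e\<in>F. p e)" if "F \<subseteq> I" for F
    using p that by (intro prod_nonneg) auto
  \<comment> \<open>Here the walk must not reuse an edge: only for a new \<open>e\<close> does its
    probability enter the product as a further factor.\<close>
  have step: "(\<Prod>e\<in>F. of_bool (S e)) * of_bool (S e) = (\<Prod>e\<in>insert e F. of_bool (S e) :: real)"
    "(\<Prod>e\<in>F. p e) * p e = (\<Prod>e\<in>insert e F. p e)"
    if "F \<subseteq> I" "e \<notin> F" for F e and S :: "nat set \<Rightarrow> bool"
    using that finite_subset[OF that(1) I(1)] by simp_all
  have "integrable M (\<lambda>S. (\<Prod>e\<in>F. of_bool (S e)) * closing_walks I S m v D F) \<and>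
    (\<integral>S. (\<Prod>e\<in>F. of_bool (S e)) * closing_walks I S m v D F \<partial>M) \<le>
      (\<Prod>e\<in>F. p e) * ((real (card D) + real m * real \<Delta>) * c * L ^ m)"
    using vDF
  proof (induction m arbitrary: v D F)
    case 0
    let ?E = "{e. e \<in> I \<and> v \<in> e \<and> e \<notin> F}"
    have eq: "(\<Prod>e\<in>F. of_bool (S e)) * closing_walks I S 0 v D F =
      (\<Sum>e\<in>?E. \<Sum>w\<in>(e - {v}) \<inter> D. \<Prod>e\<in>insert e F. of_bool (S e))" for S
      using 0 by (simp only: closing_walks.simps sum_distrib_left, intro sum.cong refl step) auto
    have single: "has_bochner_integral M (\<lambda>S. \<Prod>e\<in>insert e F. of_bool (S e)) (\<Prod>e\<in>insert e F. p e)" if "e \<in> ?E" for e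
      using 0 that by (intro prod) auto
    have total: "has_bochner_integral M (\<lambda>S. (\<Prod>e\<in>F. of_bool (S e)) * closing_walks I S 0 v D F)
      (\<Sum>e\<in>?E. \<Sum>w\<in>(e - {v}) \<inter> D. \<Prod>e\<in>insert e F. p e)"
      unfolding eq by (intro has_bochner_integral_sum single)
    have "(\<Sum>e\<in>?E. \<Sum>w\<in>(e - {v}) \<inter> D. \<Prod>e\<in>insert e F. p e) = (\<Prod>e\<in>F. p e) * (\<Sum>e\<in>?E. \<Sum>w\<in>(e - {v}) \<inter> D. p e)"
      using 0 by (simp only: sum_distrib_left, intro sum.cong refl step(2)[symmetric]) auto
    also have "\<dots> \<le> (\<Prod>e\<in>F. p e) * (\<Sum>e | e \<in> I \<and> v \<in> e. \<Sum>w\<in>(e - {v}) \<inter> D. p e)"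
      using I(1) p 0 by (intro mult_left_mono sum_mono2 pF) (auto intro!: sum_nonneg)
    also have "\<dots> \<le> (\<Prod>e\<in>F. p e) * (real (card (D - {v})) * c)"
      using 0 by (intro mult_left_mono inner pF) auto
    also have "\<dots> \<le> (\<Prod>e\<in>F. p e) * (real (card D) * c)"
      using 0 c(2) finite_subset[OF _ I(2)] by (intro mult_left_mono mult_right_mono pF) (auto intro!: card_mono)
    finally show ?case
      using total by (simp add: has_bochner_integral_iff)
  next
    case (Suc m)
    let ?E = "{e. e \<in> I \<and> v \<in> e \<and> e \<notin> F}"
    let ?B = "(real (card D) + real (Suc m) * real \<Delta>) * c * L ^ m"
    let ?t = "\<lambda>e w S. (\<Prod>e\<in>insert e F. of_bool (S e)) * closing_walks I S m w (D \<union> e) (insert e F)"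
    have B0: "0 \<le> ?B" using c(2) L0 by simp
    have eq: "(\<Prod>e\<in>F. of_bool (S e)) * closing_walks I S (Suc m) v D F = (\<Sum>e\<in>?E. \<Sum>w\<in>e - {v}. ?t e w S)" for S
      using Suc.prems
      by (simp only: closing_walks.simps sum_distrib_left mult.assoc[symmetric], intro sum.cong refl)
        (simp add: step(1))
    have IH: "integrable M (?t e w)" "(\<integral>S. ?t e w S \<partial>M) \<le> (\<Prod>e\<in>insert e F. p e) * ?B"
      if ew: "e \<in> ?E" "w \<in> e - {v}" for e w
    proof -
      have *: "w \<in> V" "D \<union> e \<subseteq> V" "insert e F \<subseteq> I"
        using ew Suc.prems I(3) by auto
      show "integrable M (?t e w)" using Suc.IH[OF *] by blast
      have "card (D \<union> e) \<le> card D + \<Delta>"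
        using ew I(4)[of e] card_Un_le[of D e] by simp
      then have "real (card (D \<union> e)) \<le> real (card D) + real \<Delta>"
        by (simp flip: of_nat_add)
      then have "real (card (D \<union> e)) + real m * real \<Delta> \<le> real (card D) + real (Suc m) * real \<Delta>"
        by (simp add: algebra_simps)
      then have "(real (card (D \<union> e)) + real m * real \<Delta>) * c * L ^ m \<le> ?B"
        using c(2) L0 by (intro mult_right_mono) auto
      then show "(\<integral>S. ?t e w S \<partial>M) \<le> (\<Prod>e\<in>insert e F. p e) * ?B"
        using Suc.IH[OF *] mult_left_mono[OF _ pF[OF *(3)]] by (meson order_trans)
    qed
    have int: "integrable M (\<lambda>S. (\<Prod>e\<in>F. of_bool (S e)) * closing_walks I S (Suc m) v D F)"
      unfolding eq by (intro Bochner_Integration.integrable_sum IH)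
    have "(\<integral>S. (\<Prod>e\<in>F. of_bool (S e)) * closing_walks I S (Suc m) v D F \<partial>M) =
        (\<Sum>e\<in>?E. \<Sum>w\<in>e - {v}. \<integral>S. ?t e w S \<partial>M)"
      unfolding eq
      by (intro has_bochner_integral_integral_eq has_bochner_integral_sum has_bochner_integral_integrable IH(1))
    also have "\<dots> \<le> (\<Sum>e\<in>?E. \<Sum>w\<in>e - {v}. (\<Prod>e\<in>insert e F. p e) * ?B)"
      by (intro sum_mono IH)
    also have "\<dots> = (\<Prod>e\<in>F. p e) * ((\<Sum>e\<in>?E. \<Sum>w\<in>e - {v}. p e) * ?B)"
      using Suc.prems
      by (simp only: sum_distrib_left sum_distrib_right, intro sum.cong refl)
        (simp add: step(2)[symmetric])
    also have "\<dots> \<le> (\<Prod>e\<in>F. p e) * ((\<Sum>e | e \<in> I \<and> v \<in> e. \<Sum>w\<in>e - {v}. p e) * ?B)"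
      using I(1) p Suc.prems B0
      by (intro mult_left_mono mult_right_mono sum_mono2 pF) (auto intro!: sum_nonneg)
    also have "\<dots> \<le> (\<Prod>e\<in>F. p e) * (L * ?B)"
      using Suc.prems B0 by (intro mult_left_mono mult_right_mono L pF) auto
    also have "\<dots> = (\<Prod>e\<in>F. p e) * ((real (card D) + real (Suc m) * real \<Delta>) * c * L ^ Suc m)"
      by (simp add: mult_ac)
    finally show ?case using int by blast
  qed
  then show "integrable M (\<lambda>S. (\<Prod>e\<in>F. of_bool (S e)) * closing_walks I S m v D F)"
    and "(\<integral>S. (\<Prod>e\<in>F. of_bool (S e)) * closing_walks I S m v D F \<partial>M) \<le>
      (\<Prod>e\<in>F. p e) * ((real (card D) + real m * real \<Delta>) * c * L ^ m)"
    by auto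
qed

section \<open>Edge probabilities in the random hypergraph\<close>

lemma edge_prob_bounds:
  assumes "admissible_size \<Delta> \<alpha> N" "e \<in> potential_edges \<Delta> N"
  shows "0 \<le> edge_prob \<alpha> N (card e)" "edge_prob \<alpha> N (card e) \<le> 1"
  using assms by (auto simp: admissible_size_def potential_edges_def)

lemma prob_space_selection_law: "prob_space (selection_law \<Delta> \<alpha> N)"
  unfolding selection_law_def by (intro prob_space_PiM measure_pmf.prob_space_axioms)

lemma selection_law_prod:
  assumes adm: "admissible_size \<Delta> \<alpha> N" and F: "F \<subseteq> potential_edges \<Delta> N"
  shows "has_bochner_integral (selection_law \<Delta> \<alpha> N) (\<lambda>S. \<Prod>e\<in>F. of_bool (S e))
    (\<Prod>e\<in>F. edge_prob \<alpha> N (card e))"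
proof -
  let ?I = "potential_edges \<Delta> N"
  interpret S: prob_space "selection_law \<Delta> \<alpha> N" by (rule prob_space_selection_law)
  interpret P: product_prob_space "\<lambda>e. measure_pmf (bernoulli_pmf (edge_prob \<alpha> N (card e)))" ?I
    by unfold_locales
  \<comment> \<open>Factors 1 outside \<open>F\<close> extend the product to all coordinates of the
    product measure.\<close>
  let ?f = "\<lambda>e b. if e \<in> F then of_bool b else 1 :: real"
  have eq: "(\<Prod>e\<in>?I. ?f e (S e)) = (\<Prod>e\<in>F. of_bool (S e))" for S
    using F finite_potential_edges[of \<Delta> N] by (simp add: prod.If_cases Int_absorb1)
  have [measurable]: "(\<lambda>S. of_bool (S e) :: real) \<in> borel_measurable (selection_law \<Delta> \<alpha> N)" if "e \<in> F" for e
  proof -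
    have "(\<lambda>S. S e) \<in> measurable (selection_law \<Delta> \<alpha> N) (measure_pmf (bernoulli_pmf (edge_prob \<alpha> N (card e))))"
      using that F unfolding selection_law_def by (intro measurable_component_singleton) auto
    then have [measurable]: "(\<lambda>S. S e) \<in> measurable (selection_law \<Delta> \<alpha> N) (count_space UNIV)"
      by (simp cong: measurable_cong_sets)
    show ?thesis by measurable
  qed
  have "integrable (selection_law \<Delta> \<alpha> N) (\<lambda>S. \<Prod>e\<in>F. of_bool (S e) :: real)"
    by (rule S.integrable_const_bound[where B = 1]) (auto simp: abs_prod intro!: prod_le_1)
  moreover have "(\<integral>S. (\<Prod>e\<in>F. of_bool (S e)) \<partial>selection_law \<Delta> \<alpha> N) = (\<Prod>e\<in>F. edge_prob \<alpha> N (card e))"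
  proof -
    have "(\<integral>S. (\<Prod>e\<in>?I. ?f e (S e)) \<partial>selection_law \<Delta> \<alpha> N) =
      (\<Prod>e\<in>?I. \<integral>b. ?f e b \<partial>measure_pmf (bernoulli_pmf (edge_prob \<alpha> N (card e))))"
      unfolding selection_law_def
      by (intro P.product_integral_prod finite_potential_edges integrable_measure_pmf_finite)
        (auto intro: finite_subset[of _ UNIV])
    also have "\<dots> = (\<Prod>e\<in>?I. if e \<in> F then edge_prob \<alpha> N (card e) else 1)"
      using edge_prob_bounds[OF adm] by (intro prod.cong refl) auto
    also have "\<dots> = (\<Prod>e\<in>F. edge_prob \<alpha> N (card e))"
      using F finite_potential_edges[of \<Delta> N] by (simp add: prod.If_cases Int_absorb1)
    finally show ?thesis by (simp only: eq)
  qed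
  ultimately show ?thesis by (simp add: has_bochner_integral_iff)
qed

lemma card_edges_through_pair:
  assumes "v \<in> {1..N}" "w \<in> {1..N}" "v \<noteq> w" "2 \<le> p"
  shows "card {e. e \<subseteq> {1..N} \<and> card e = p \<and> v \<in> e \<and> w \<in> e} = (N - 2) choose (p - 2)"
proof -
  let ?W = "{1..N} - {v, w}"
  have fin: "finite e" if "e \<subseteq> {1..N}" for e using that finite_subset by blast
  have "bij_betw (\<lambda>e. e \<union> {v, w}) {e. e \<subseteq> ?W \<and> card e = p - 2} {e. e \<subseteq> {1..N} \<and> card e = p \<and> v \<in> e \<and> w \<in> e}"
  proof (rule bij_betw_byWitness[where f' = "\<lambda>e. e - {v, w}"])
    show "(\<lambda>e. e \<union> {v, w}) ` {e. e \<subseteq> ?W \<and> card e = p - 2} \<subseteq> {e. e \<subseteq> {1..N} \<and> card e = p \<and> v \<in> e \<and> w \<in> e}"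
    proof clarify
      fix e assume e: "e \<subseteq> ?W" "card e = p - 2"
      then have "finite e" using fin[of e] by blast
      then have "card (e \<union> {v, w}) = card e + card {v, w}"
        using e by (intro card_Un_disjoint) auto
      then show "e \<union> {v, w} \<subseteq> {1..N} \<and> card (e \<union> {v, w}) = p \<and> v \<in> e \<union> {v, w} \<and> w \<in> e \<union> {v, w}"
        using e assms by auto
    qed
    show "(\<lambda>e. e - {v, w}) ` {e. e \<subseteq> {1..N} \<and> card e = p \<and> v \<in> e \<and> w \<in> e} \<subseteq> {e. e \<subseteq> ?W \<and> card e = p - 2}"
      using fin assms(3) by (auto simp: card_Diff_subset)
  qed auto
  then have "card {e. e \<subseteq> {1..N} \<and> card e = p \<and> v \<in> e \<and> w \<in> e} = card {e. e \<subseteq> ?W \<and> card e = p - 2}"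
    using bij_betw_same_card by fastforce
  also have "\<dots> = card ?W choose (p - 2)"
    by (intro n_subsets) auto
  also have "card ?W = N - 2"
    using assms by (simp add: card_Diff_subset)
  finally show ?thesis .
qed

text \<open>This is where lambda comes from: absorbing twice in the binomial coefficient gives each
  p the share p (p - 1) \<open>\<alpha> p\<close> / (N - 1) of the expected number of selected edges
  through a pair of vertices.\<close>

lemma edge_prob_through_pair:
  assumes vw: "v \<in> {1..N}" "w \<in> {1..N}" "v \<noteq> w" and N: "\<Delta> \<le> N"
  shows "(\<Sum>e | e \<in> potential_edges \<Delta> N \<and> v \<in> e \<and> w \<in> e. edge_prob \<alpha> N (card e)) =
    (\<Sum>p = 2..\<Delta>. real p * (real p - 1) * \<alpha> p) / (real N - 1)"
proof -
  let ?E = "{e. e \<in> potential_edges \<Delta> N \<and> v \<in> e \<and> w \<in> e}"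
  have "(\<Sum>e\<in>?E. edge_prob \<alpha> N (card e)) =
      (\<Sum>p\<in>{2..\<Delta>}. \<Sum>e | e \<in> ?E \<and> card e = p. edge_prob \<alpha> N (card e))"
    using finite_potential_edges[of \<Delta> N]
    by (intro sum.group[symmetric]) (auto simp: potential_edges_def)
  also have "\<dots> = (\<Sum>p\<in>{2..\<Delta>}. real p * (real p - 1) * \<alpha> p / (real N - 1))"
  proof (intro sum.cong refl)
    fix p assume p: "p \<in> {2..\<Delta>}"
    have E: "{e. e \<in> ?E \<and> card e = p} = {e. e \<subseteq> {1..N} \<and> card e = p \<and> v \<in> e \<and> w \<in> e}"
      using p by (auto simp: potential_edges_def)
    \<comment> \<open>The shift by two avoids truncated subtraction in the absorption
      identities.\<close>
    define k M where "k = p - 2" and "M = N - 2"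
    have pN: "p = Suc (Suc k)" "N = Suc (Suc M)" "k \<le> M"
      using p N by (auto simp: k_def M_def)
    have b1: "Suc (Suc k) * (Suc (Suc M) choose Suc (Suc k)) = Suc (Suc M) * (Suc M choose Suc k)"
      by (rule Suc_times_binomial)
    have b2: "Suc k * (Suc M choose Suc k) = Suc M * (M choose k)"
      by (rule Suc_times_binomial)
    have "real p * (real p - 1) * real (N choose p) = real N * (real N - 1) * real (M choose k)"
    proof -
      have "Suc (Suc k) * Suc k * (Suc (Suc M) choose Suc (Suc k)) = Suc (Suc M) * (Suc k * (Suc M choose Suc k))"
        using b1 by (metis mult.assoc mult.left_commute)
      then have "Suc (Suc k) * Suc k * (N choose p) = N * (Suc M * (M choose k))"
        unfolding b2 pN .
      then have "real (Suc (Suc k)) * real (Suc k) * real (N choose p) = real N * (real (Suc M) * real (M choose k))"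
        by (metis of_nat_mult)
      moreover have "real (Suc k) = real p - 1" "real (Suc M) = real N - 1" "real (Suc (Suc k)) = real p"
        using pN by simp_all
      ultimately show ?thesis by (simp only: mult.assoc)
    qed
    note key = this
    have pos: "0 < real (N choose p)" "0 < real N - 1" "0 < real N"
      using p N by (simp_all add: zero_less_binomial_iff)
    have "real (M choose k) * edge_prob \<alpha> N p =
        real N * (real N - 1) * real (M choose k) * \<alpha> p / (real (N choose p) * (real N - 1))"
      using pos by (simp add: edge_prob_def)
    also have "\<dots> = real p * (real p - 1) * \<alpha> p / (real N - 1)"
      unfolding key[symmetric] using pos by simp
    finally have "real (M choose k) * edge_prob \<alpha> N p = real p * (real p - 1) * \<alpha> p / (real N - 1)" .
    then show "(\<Sum>e | e \<in> ?E \<and> card e = p. edge_prob \<alpha> N (card e)) = real p * (real p - 1) * \<alpha> p / (real N - 1)"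
      unfolding E using card_edges_through_pair[OF vw, of p] p by (simp add: k_def M_def)
  qed
  finally show ?thesis by (simp add: sum_divide_distrib)
qed

lemma expected_closing_walks:
  assumes adm: "admissible_size \<Delta> \<alpha> N" and \<alpha>: "\<And>p. p \<in> {2..\<Delta>} \<Longrightarrow> \<alpha> p > 0" and "2 \<le> \<Delta>"
    and ij: "i \<in> {1..N}" "j \<in> {1..N}"
  defines "lam \<equiv> (\<Sum>p = 2..\<Delta>. real p * (real p - 1) * \<alpha> p)"
  shows "integrable (selection_law \<Delta> \<alpha> N) (\<lambda>S. closing_walks (potential_edges \<Delta> N) S m i {i, j} {})"
    and "(\<integral>S. closing_walks (potential_edges \<Delta> N) S m i {i, j} {} \<partial>selection_law \<Delta> \<alpha> N) \<le>
      (2 + real m * real \<Delta>) * lam ^ Suc m / (real N - 1)"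
proof -
  have N: "\<Delta> \<le> N" using adm by (simp add: admissible_size_def)
  with \<open>2 \<le> \<Delta>\<close> have N1: "0 < real N - 1" by simp
  have lam0: "0 \<le> lam"
    unfolding lam_def using \<alpha> by (intro sum_nonneg mult_nonneg_nonneg) (auto intro: less_imp_le)
  note * = closing_walks_expectation[where I = "potential_edges \<Delta> N" and V = "{1..N}" and c = "lam / (real N - 1)"
      and \<Delta> = \<Delta> and v = i and D = "{i, j}" and F = "{}" and M = "selection_law \<Delta> \<alpha> N" and m = m
      and p = "\<lambda>e. edge_prob \<alpha> N (card e)", OF finite_potential_edges finite_atLeastAtMost _ _ _ _
      edge_prob_bounds(1)[OF adm] selection_law_prod[OF adm]]
  have edges: "e \<subseteq> {1..N}" "card e \<le> \<Delta>" if "e \<in> potential_edges \<Delta> N" for e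
    using that by (simp_all add: potential_edges_def)
  have pair: "(\<Sum>e | e \<in> potential_edges \<Delta> N \<and> v \<in> e \<and> w \<in> e. edge_prob \<alpha> N (card e)) \<le> lam / (real N - 1)"
    if "v \<in> {1..N}" "w \<in> {1..N}" "v \<noteq> w" for v w
    using edge_prob_through_pair[OF that N, of \<alpha>] by (simp add: lam_def)
  have c: "0 \<le> lam / (real N - 1)" using lam0 N1 by simp
  have sub: "{i, j} \<subseteq> {1..N}" using ij by simp
  show "integrable (selection_law \<Delta> \<alpha> N) (\<lambda>S. closing_walks (potential_edges \<Delta> N) S m i {i, j} {})"
    using *(1)[OF edges pair c _ _ ij(1) sub] by simp
  \<comment> \<open>With N - 1 candidates for the next vertex, the branching bound is lambda
    itself.\<close>
  have L: "(real (card {1..N}) - 1) * (lam / (real N - 1)) = lam"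
    using N1 by simp
  have "(\<integral>S. closing_walks (potential_edges \<Delta> N) S m i {i, j} {} \<partial>selection_law \<Delta> \<alpha> N) \<le>
      (real (card {i, j}) + real m * real \<Delta>) * (lam / (real N - 1)) * lam ^ m"
    using *(2)[OF edges pair c _ _ ij(1) sub] unfolding L by simp
  also have "\<dots> \<le> (2 + real m * real \<Delta>) * (lam / (real N - 1)) * lam ^ m"
    using lam0 N1 by (intro mult_right_mono add_right_mono) (auto simp: card_insert_if)
  finally show "(\<integral>S. closing_walks (potential_edges \<Delta> N) S m i {i, j} {} \<partial>selection_law \<Delta> \<alpha> N) \<le>
      (2 + real m * real \<Delta>) * lam ^ Suc m / (real N - 1)"
    by (simp add: mult_ac)
qed

subsection \<open>Decay of the overlap\<close>

lemma mult_le_1_of_abs: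
  fixes x y :: real
  assumes "\<bar>x\<bar> \<le> 1" "\<bar>y\<bar> \<le> 1"
  shows "x * y \<le> 1"
  using mult_mono[OF assms] abs_ge_self[of "x * y"] by (simp add: abs_mult)

lemma expectation_pair_pmf_mult:
  fixes f :: "'a \<Rightarrow> real" and g :: "'b \<Rightarrow> real"
  assumes "finite (set_pmf p)" "finite (set_pmf q)"
  shows "measure_pmf.expectation (pair_pmf p q) (\<lambda>(x, y). f x * g y) =
    measure_pmf.expectation p f * measure_pmf.expectation q g"
proof -
  have "measure_pmf.expectation (pair_pmf p q) (\<lambda>(x, y). f x * g y) =
      (\<Sum>z\<in>set_pmf p \<times> set_pmf q. (case z of (x, y) \<Rightarrow> f x * g y) * pmf (pair_pmf p q) z)"
    using assms by (intro integral_measure_pmf_real) auto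
  also have "\<dots> = (\<Sum>x\<in>set_pmf p. \<Sum>y\<in>set_pmf q. (f x * pmf p x) * (g y * pmf q y))"
    by (subst sum.cartesian_product) (auto intro!: sum.cong simp: pmf_pair)
  also have "\<dots> = (\<Sum>x\<in>set_pmf p. f x * pmf p x) * (\<Sum>y\<in>set_pmf q. g y * pmf q y)"
    by (simp only: sum_product)
  also have "(\<Sum>x\<in>set_pmf p. f x * pmf p x) = measure_pmf.expectation p f"
    using assms by (intro integral_measure_pmf_real[symmetric]) auto
  also have "(\<Sum>y\<in>set_pmf q. g y * pmf q y) = measure_pmf.expectation q g"
    using assms by (intro integral_measure_pmf_real[symmetric]) auto
  finally show ?thesis .
qed

lemma gibbs_average_overlap:
  "gibbs_average \<Delta> \<rho> N \<beta> S J Jt (\<lambda>\<sigma> \<tau>. (overlap N \<sigma> \<tau>)\<^sup>2) =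
    1 / (real N)\<^sup>2 * (\<Sum>i = 1..N. \<Sum>j = 1..N. correlation \<Delta> \<rho> N \<beta> S i j J * correlation \<Delta> \<rho> N \<beta> S i j Jt)"
proof -
  let ?p = "gibbs N \<beta> (hamiltonian \<Delta> \<rho> N S J)" and ?q = "gibbs N \<beta> (hamiltonian \<Delta> \<rho> N S Jt)"
  have fin: "finite (set_pmf ?p)" "finite (set_pmf ?q)"
    by (rule finite_subset[OF set_pmf_gibbs finite_configs])+
  have sq: "(overlap N \<sigma> \<tau>)\<^sup>2 = (\<Sum>i = 1..N. \<Sum>j = 1..N. 1 / (real N)\<^sup>2 * ((\<sigma> i * \<sigma> j) * (\<tau> i * \<tau> j)))" for \<sigma> \<tau>
    by (simp add: overlap_def power2_eq_square sum_product sum_divide_distrib mult_ac)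
  have "gibbs_average \<Delta> \<rho> N \<beta> S J Jt (\<lambda>\<sigma> \<tau>. (overlap N \<sigma> \<tau>)\<^sup>2) =
    (\<Sum>i = 1..N. \<Sum>j = 1..N. measure_pmf.expectation (pair_pmf ?p ?q)
      (\<lambda>z. 1 / (real N)\<^sup>2 * (case z of (\<sigma>, \<tau>) \<Rightarrow> (\<sigma> i * \<sigma> j) * (\<tau> i * \<tau> j))))"
    unfolding gibbs_average_def sq case_prod_beta
    by (intro has_bochner_integral_integral_eq has_bochner_integral_sum has_bochner_integral_integrable
        integrable_measure_pmf_finite) (simp add: fin)
  also have "\<dots> = (\<Sum>i = 1..N. \<Sum>j = 1..N. 1 / (real N)\<^sup>2 *
      (correlation \<Delta> \<rho> N \<beta> S i j J * correlation \<Delta> \<rho> N \<beta> S i j Jt))"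
    unfolding correlation_def
    by (intro sum.cong refl, subst integral_mult_right_zero, subst expectation_pair_pmf_mult[OF fin], rule refl)
  finally show ?thesis by (simp only: sum_distrib_left)
qed

section \<open>A single correlation on a fixed hypergraph\<close>

lemma hamiltonian_cong:
  assumes "\<And>e. e \<in> potential_edges \<Delta> N \<Longrightarrow> J e = J' e"
  shows "hamiltonian \<Delta> \<rho> N S J = hamiltonian \<Delta> \<rho> N S J'"
  unfolding hamiltonian_def
  by (intro ext sum.cong refl arg_cong2[where f = "(*)"] arg_cong[where f = "\<rho> _"] assms)
    (auto simp: edges_def potential_edges_def)

lemma correlation_cong:
  assumes "\<And>e. e \<in> potential_edges \<Delta> N \<Longrightarrow> J e = J' e"
  shows "correlation \<Delta> \<rho> N \<beta> S i j J = correlation \<Delta> \<rho> N \<beta> S i j J'"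
  unfolding correlation_def using hamiltonian_cong[OF assms] by simp

lemma measurable_hamiltonian:
  assumes \<rho>: "\<forall>p\<in>{2..\<Delta>}. \<rho> p \<in> borel_measurable borel"
  shows "(\<lambda>J. hamiltonian \<Delta> \<rho> N S J \<sigma>) \<in> borel_measurable (\<Pi>\<^sub>M e\<in>potential_edges \<Delta> N. borel)"
  unfolding hamiltonian_def
proof (intro borel_measurable_sum borel_measurable_times borel_measurable_const)
  fix p e assume p: "p \<in> {2..\<Delta>}" and "e \<in> edges N S p"
  then have "e \<in> potential_edges \<Delta> N" by (auto simp: edges_def potential_edges_def)
  then have "(\<lambda>J. J e) \<in> measurable (\<Pi>\<^sub>M e\<in>potential_edges \<Delta> N. borel :: real measure) borel"
    by (rule measurable_component_singleton)
  then show "(\<lambda>J. \<rho> p (J e)) \<in> borel_measurable (\<Pi>\<^sub>M e\<in>potential_edges \<Delta> N. borel)"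
    by (rule measurable_compose) (use \<rho> p in blast)
qed

lemma measurable_correlation:
  assumes \<rho>: "\<forall>p\<in>{2..\<Delta>}. \<rho> p \<in> borel_measurable borel"
  shows "correlation \<Delta> \<rho> N \<beta> S i j \<in> borel_measurable (\<Pi>\<^sub>M e\<in>potential_edges \<Delta> N. borel)"
proof -
  note [measurable] = measurable_hamiltonian[OF \<rho>]
  have [measurable]: "Measurable.pred (\<Pi>\<^sub>M e\<in>potential_edges \<Delta> N. borel)
      (\<lambda>J. \<forall>\<tau>\<in>configs N. hamiltonian \<Delta> \<rho> N S J \<tau> \<le> hamiltonian \<Delta> \<rho> N S J \<sigma>)" for \<sigma>
    by (intro pred_intros_finite finite_configs, unfold pred_def)
      (intro borel_measurable_le measurable_hamiltonian \<rho>)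
  have [measurable]: "(\<lambda>J. gibbs_weight N \<beta> (hamiltonian \<Delta> \<rho> N S J) \<sigma>) \<in>
      borel_measurable (\<Pi>\<^sub>M e\<in>potential_edges \<Delta> N. borel)" for \<sigma>
    unfolding gibbs_weight_def by (cases "\<beta> = \<infinity>") simp_all
  show ?thesis
    unfolding correlation_def gibbs_expectation by measurable
qed

text \<open>The disorder without the hypergraph, so that estimates can be made for fixed
  \<open>S\<close> and averaged over \<open>S\<close> afterwards.\<close>

definition bond_law :: "nat \<Rightarrow> nat \<Rightarrow> real \<Rightarrow> ((nat set \<Rightarrow> real) \<times> (nat set \<Rightarrow> real) \<times> (nat set \<Rightarrow> bool)) measure" where
  "bond_law \<Delta> N t = gaussian_law \<Delta> N \<Otimes>\<^sub>M (gaussian_law \<Delta> N \<Otimes>\<^sub>M resampling_law \<Delta> N t)"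

lemma prob_space_bond_law: "prob_space (bond_law \<Delta> N t)"
  unfolding bond_law_def gaussian_law_def resampling_law_def
  by (intro prob_space_pair prob_space_PiM prob_space_std_gaussian measure_pmf.prob_space_axioms)

lemma perturbed_eq_perturb: "perturbed \<pi> t J J' B e = perturb \<pi> t (J e, J' e, B e)"
  by (cases \<pi>) simp_all

text \<open>A pointwise form of Markov's inequality in \<open>S\<close>: the walk sum replaces the
  indicator that a short parity class exists. Below 1 it excludes such classes and
  \<open>noise_bound\<close> applies with degree \<open>Suc K\<close>; from 1 on the trivial bound
  is enough.\<close>

lemma correlation_decay:
  assumes t: "t > 0" and \<rho>: "\<forall>p\<in>{2..\<Delta>}. \<rho> p \<in> borel_measurable borel \<and> (\<forall>x. \<rho> p (- x) = - \<rho> p x)"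
    and ij: "i \<in> {1..N}" "j \<in> {1..N}"
  shows "integrable (bond_law \<Delta> N t) (\<lambda>(J, J', B). correlation \<Delta> \<rho> N \<beta> S i j J *
      correlation \<Delta> \<rho> N \<beta> S i j (perturbed \<pi> t J J' B))" (is ?integrable)
    and "(\<integral>(J, J', B). correlation \<Delta> \<rho> N \<beta> S i j J *
      correlation \<Delta> \<rho> N \<beta> S i j (perturbed \<pi> t J J' B) \<partial>bond_law \<Delta> N t) \<le>
      (if i = j then 1 else exp (- t) ^ Suc K + (\<Sum>m<K. closing_walks (potential_edges \<Delta> N) S m i {i, j} {}))"
    (is "?lhs \<le> _")
proof -
  let ?I = "potential_edges \<Delta> N"
  let ?f = "correlation \<Delta> \<rho> N \<beta> S i j"
  let ?Q = "\<Pi>\<^sub>M e\<in>?I. coupling_law t"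
  let ?z = "\<lambda>(J, J', B). \<lambda>e\<in>?I. (J e, J' e, B e)"
  interpret noisy_pair "coupling_law t" fst "perturb \<pi> t" "exp (- t)"
    by (rule noisy_pair_coupling_law[OF t])
  interpret Q: prob_space ?Q
    by (rule prob_space_PiM) (rule prob_space_coupling_law)
  have \<rho>m: "\<forall>p\<in>{2..\<Delta>}. \<rho> p \<in> borel_measurable borel" and \<rho>odd: "\<forall>p\<in>{2..\<Delta>}. \<forall>x. \<rho> p (- x) = - \<rho> p x"
    using \<rho> by auto
  note [measurable] = measurable_correlation[OF \<rho>m]
  have abs1: "\<bar>?f J\<bar> \<le> 1" for J
    by (rule correlation_bounded[OF ij])
  then have bd: "bounded (range ?f)"
    by (auto simp: bounded_iff)
  have z [measurable]: "?z \<in> measurable (bond_law \<Delta> N t) ?Q"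
    unfolding bond_law_def gaussian_law_def resampling_law_def coupling_law_def by (rule measurable_zip3_PiM)
  have distr: "distr (bond_law \<Delta> N t) ?Q ?z = ?Q"
    unfolding bond_law_def gaussian_law_def resampling_law_def coupling_law_def
    by (intro distr_zip_PiM finite_potential_edges prob_space_std_gaussian measure_pmf.prob_space_axioms)
  \<comment> \<open>A correlation depends only on the couplings of potential edges, so it does not
    see the restriction in \<open>Xs\<close> and \<open>Ys\<close>.\<close>
  have eq: "(\<lambda>(J, J', B). ?f J * ?f (perturbed \<pi> t J J' B)) = (\<lambda>p. ?f (Xs ?I (?z p)) * ?f (Ys ?I (?z p)))"
    by (auto simp: fun_eq_iff Xs_def Ys_def perturbed_eq_perturb intro!: arg_cong2[where f = "(*)"] correlation_cong)
  have intQ: "integrable ?Q (\<lambda>w. ?f (Xs ?I w) * ?f (Ys ?I w))"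
    by (intro Q.integrable_bounded_range bounded_range_mult bounded_range_comp[OF bd]) measurable
  then show ?integrable
    unfolding eq using integrable_distr[OF z, of "\<lambda>w. ?f (Xs ?I w) * ?f (Ys ?I w)"] by (simp add: distr)
  have lhs: "?lhs = (\<integral>w. ?f (Xs ?I w) * ?f (Ys ?I w) \<partial>?Q)"
    unfolding eq by (subst distr[symmetric], subst integral_distr[OF z]) measurable
  have abs_mult1: "?f x * ?f y \<le> 1" for x y
    by (intro mult_le_1_of_abs abs1)
  have le1: "(\<integral>w. ?f (Xs ?I w) * ?f (Ys ?I w) \<partial>?Q) \<le> 1"
    using integral_mono[OF intQ, of "\<lambda>_. 1"] abs_mult1 by (simp add: Q.prob_space)
  show "?lhs \<le> (if i = j then 1 else exp (- t) ^ Suc K + (\<Sum>m<K. closing_walks ?I S m i {i, j} {}))"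
  proof (cases "i = j")
    case True
    with le1 lhs show ?thesis by simp
  next
    case False
    have nonneg: "0 \<le> (\<Sum>m<K. closing_walks ?I S m i {i, j} {})"
      by (intro sum_nonneg) (simp add: closing_walks_nonneg)
    show ?thesis
    proof (cases "(\<Sum>m<K. closing_walks ?I S m i {i, j} {}) < 1")
      case True
      note deg = high_degree_correlation[OF \<rho>odd ij False True]
      have sq: "(\<integral>w. (?f (h w))\<^sup>2 \<partial>?Q) \<le> 1" if [measurable]: "h \<in> measurable ?Q (\<Pi>\<^sub>M e\<in>?I. borel)" for h
      proof -
        have "integrable ?Q (\<lambda>w. ?f (h w) * ?f (h w))"
          by (intro Q.integrable_bounded_range bounded_range_mult bounded_range_comp[OF bd]) measurable
        from integral_mono[OF this, of "\<lambda>_. 1"] abs_mult1 show ?thesis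
          by (simp add: Q.prob_space power2_eq_square)
      qed
      have "?lhs \<le> exp (- t) ^ Suc K * ((\<integral>w. (?f (Xs ?I w))\<^sup>2 \<partial>?Q) + (\<integral>w. (?f (Ys ?I w))\<^sup>2 \<partial>?Q)) / 2"
        unfolding lhs by (rule noise_bound[OF finite_potential_edges _ _ bd bd deg deg]) measurable
      also have "\<dots> \<le> exp (- t) ^ Suc K * (1 + 1) / 2"
        by (intro divide_right_mono mult_left_mono add_mono sq measurable_Xs measurable_Ys) auto
      finally show ?thesis using False nonneg by simp
    next
      case False
      have "0 \<le> exp (- t) ^ Suc K" by simp
      with False le1 have "?lhs \<le> exp (- t) ^ Suc K + (\<Sum>m<K. closing_walks ?I S m i {i, j} {})"
        unfolding lhs by linarith
      with \<open>i \<noteq> j\<close> show ?thesis by simp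
    qed
  qed
qed

text \<open>Serves the case t = 0, where the target exponent is 0.\<close>

lemma mean_square_overlap_le_1:
  assumes "N > 0"
  shows "mean_square_overlap \<pi> \<Delta> \<alpha> \<rho> N \<beta> t \<le> 1"
proof -
  let ?g = "\<lambda>(S, J, J', B). gibbs_average \<Delta> \<rho> N \<beta> S J (perturbed \<pi> t J J' B) (\<lambda>\<sigma> \<tau>. (overlap N \<sigma> \<tau>)\<^sup>2)"
  interpret prob_space "disorder_law \<Delta> \<alpha> N t"
    unfolding disorder_law_def bond_law_def[symmetric]
    by (intro prob_space_pair prob_space_selection_law prob_space_bond_law)
  have "gibbs_average \<Delta> \<rho> N \<beta> S J Jt (\<lambda>\<sigma> \<tau>. (overlap N \<sigma> \<tau>)\<^sup>2) \<le> 1" for S J Jt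
  proof -
    have "correlation \<Delta> \<rho> N \<beta> S i j J * correlation \<Delta> \<rho> N \<beta> S i j Jt \<le> 1" if "i \<in> {1..N}" "j \<in> {1..N}" for i j
      by (intro mult_le_1_of_abs correlation_bounded that)
    then have "(\<Sum>i = 1..N. \<Sum>j = 1..N. correlation \<Delta> \<rho> N \<beta> S i j J * correlation \<Delta> \<rho> N \<beta> S i j Jt) \<le>
        (\<Sum>i = 1..N. \<Sum>j = 1..N. 1)"
      by (intro sum_mono) auto
    then show ?thesis
      unfolding gibbs_average_overlap using assms by (simp add: power2_eq_square divide_simps)
  qed
  then have le: "?g x \<le> 1" for x by (auto split: prod.split)
  show ?thesis
  proof (cases "integrable (disorder_law \<Delta> \<alpha> N t) ?g")
    case True
    have "(\<integral>x. ?g x \<partial>disorder_law \<Delta> \<alpha> N t) \<le> (\<integral>x. 1 \<partial>disorder_law \<Delta> \<alpha> N t)"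
      by (rule integral_mono[OF True]) (use le in auto)
    then show ?thesis by (simp add: mean_square_overlap_def prob_space)
  next
    \<comment> \<open>Here \<open>mean_square_overlap\<close> takes the default value 0.\<close>
    case False
    then show ?thesis by (simp add: mean_square_overlap_def not_integrable_integral_eq)
  qed
qed

text \<open>The N diagonal pairs out of N^2 give 1 / N. For the other pairs the couplings are
  integrated first, with the hypergraph fixed, and the remaining walk counts are then replaced by
  their expectations.\<close>

lemma mean_square_overlap_bound:
  fixes K :: nat
  assumes "2 \<le> \<Delta>" and \<alpha>: "\<And>p. p \<in> {2..\<Delta>} \<Longrightarrow> \<alpha> p > 0"
    and \<rho>: "\<forall>p\<in>{2..\<Delta>}. \<rho> p \<in> borel_measurable borel \<and> (\<forall>x. \<rho> p (- x) = - \<rho> p x)"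
    and t: "t > 0" and adm: "admissible_size \<Delta> \<alpha> N"
  defines "lam \<equiv> (\<Sum>p = 2..\<Delta>. real p * (real p - 1) * \<alpha> p)"
  shows "mean_square_overlap \<pi> \<Delta> \<alpha> \<rho> N \<beta> t \<le>
    1 / real N + exp (- t) ^ Suc K + (\<Sum>m<K. (2 + real m * real \<Delta>) * lam ^ Suc m / (real N - 1))"
proof -
  let ?g = "\<lambda>S (J, J', B). gibbs_average \<Delta> \<rho> N \<beta> S J (perturbed \<pi> t J J' B) (\<lambda>\<sigma> \<tau>. (overlap N \<sigma> \<tau>)\<^sup>2)"
  let ?W = "\<lambda>S i j. if i = j then 1 else exp (- t) ^ Suc K +
    (\<Sum>m<K. closing_walks (potential_edges \<Delta> N) S m i {i, j} {})"
  let ?G = "\<lambda>S. 1 / (real N)\<^sup>2 * (\<Sum>i = 1..N. \<Sum>j = 1..N. ?W S i j)"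
  define b where "b = exp (- t) ^ Suc K + (\<Sum>m<K. (2 + real m * real \<Delta>) * lam ^ Suc m / (real N - 1))"
  have N: "2 \<le> N" using adm \<open>2 \<le> \<Delta>\<close> by (simp add: admissible_size_def)
  have lam0: "0 \<le> lam"
    unfolding lam_def using \<alpha> by (intro sum_nonneg mult_nonneg_nonneg) (auto intro: less_imp_le)
  \<comment> \<open>Needed on the diagonal, where \<open>b\<close> is added for uniformity, and
    against the default value 0 of the integral.\<close>
  have b0: "0 \<le> b"
    unfolding b_def using lam0 N by (intro add_nonneg_nonneg sum_nonneg divide_nonneg_nonneg mult_nonneg_nonneg) auto
  interpret S: prob_space "selection_law \<Delta> \<alpha> N" by (rule prob_space_selection_law)
  interpret B: prob_space "bond_law \<Delta> N t" by (rule prob_space_bond_law)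
  interpret SB: pair_prob_space "selection_law \<Delta> \<alpha> N" "bond_law \<Delta> N t" by unfold_locales
  have inner: "(\<integral>x. ?g S x \<partial>bond_law \<Delta> N t) \<le> ?G S" for S
  proof -
    let ?c = "\<lambda>i j (J, J', B). correlation \<Delta> \<rho> N \<beta> S i j J * correlation \<Delta> \<rho> N \<beta> S i j (perturbed \<pi> t J J' B)"
    note decay = correlation_decay(1)[OF t \<rho>] correlation_decay(2)[OF t \<rho>, where K = K]
    have "?g S = (\<lambda>x. 1 / (real N)\<^sup>2 * (\<Sum>i = 1..N. \<Sum>j = 1..N. ?c i j x))"
      by (auto simp: fun_eq_iff gibbs_average_overlap)
    then have "(\<integral>x. ?g S x \<partial>bond_law \<Delta> N t) = 1 / (real N)\<^sup>2 * (\<integral>x. (\<Sum>i = 1..N. \<Sum>j = 1..N. ?c i j x) \<partial>bond_law \<Delta> N t)"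
      by (simp only: integral_mult_right_zero)
    also have "(\<integral>x. (\<Sum>i = 1..N. \<Sum>j = 1..N. ?c i j x) \<partial>bond_law \<Delta> N t) = (\<Sum>i = 1..N. \<Sum>j = 1..N. \<integral>x. ?c i j x \<partial>bond_law \<Delta> N t)"
      by (intro has_bochner_integral_integral_eq has_bochner_integral_sum has_bochner_integral_integrable decay(1))
    also have "1 / (real N)\<^sup>2 * \<dots> \<le> ?G S"
      by (intro mult_left_mono sum_mono decay(2)) auto
    finally show ?thesis .
  qed
  have W: "integrable (selection_law \<Delta> \<alpha> N) (\<lambda>S. ?W S i j)"
    "(\<integral>S. ?W S i j \<partial>selection_law \<Delta> \<alpha> N) \<le> of_bool (i = j) + b"
    if ij: "i \<in> {1..N}" "j \<in> {1..N}" for i j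
  proof -
    note cw = expected_closing_walks[OF adm \<alpha> \<open>2 \<le> \<Delta>\<close> ij, folded lam_def]
    have sum: "has_bochner_integral (selection_law \<Delta> \<alpha> N) (\<lambda>S. exp (- t) ^ Suc K + (\<Sum>m<K. closing_walks (potential_edges \<Delta> N) S m i {i, j} {}))
      (exp (- t) ^ Suc K + (\<Sum>m<K. \<integral>S. closing_walks (potential_edges \<Delta> N) S m i {i, j} {} \<partial>selection_law \<Delta> \<alpha> N))"
      using has_bochner_integral_integrable[OF S.integrable_const, of "exp (- t) ^ Suc K"]
      by (intro has_bochner_integral_add has_bochner_integral_sum has_bochner_integral_integrable cw(1)) (simp add: S.prob_space)
    then show "integrable (selection_law \<Delta> \<alpha> N) (\<lambda>S. ?W S i j)"
      by (cases "i = j") (auto simp: has_bochner_integral_iff)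
    show "(\<integral>S. ?W S i j \<partial>selection_law \<Delta> \<alpha> N) \<le> of_bool (i = j) + b"
    proof (cases "i = j")
      case True
      then show ?thesis using b0 by (simp add: S.prob_space)
    next
      case False
      have "(\<Sum>m<K. \<integral>S. closing_walks (potential_edges \<Delta> N) S m i {i, j} {} \<partial>selection_law \<Delta> \<alpha> N) \<le>
          (\<Sum>m<K. (2 + real m * real \<Delta>) * lam ^ Suc m / (real N - 1))"
        by (intro sum_mono cw(2))
      then show ?thesis
        using False sum by (simp add: has_bochner_integral_iff b_def del: power_Suc)
    qed
  qed
  have G: "integrable (selection_law \<Delta> \<alpha> N) ?G"
    by (intro integrable_mult_right Bochner_Integration.integrable_sum W)
  have bound: "(\<integral>S. ?G S \<partial>selection_law \<Delta> \<alpha> N) \<le> 1 / real N + b"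
  proof -
    have "(\<integral>S. ?G S \<partial>selection_law \<Delta> \<alpha> N) = 1 / (real N)\<^sup>2 * (\<integral>S. (\<Sum>i = 1..N. \<Sum>j = 1..N. ?W S i j) \<partial>selection_law \<Delta> \<alpha> N)"
      by (simp only: integral_mult_right_zero)
    also have "(\<integral>S. (\<Sum>i = 1..N. \<Sum>j = 1..N. ?W S i j) \<partial>selection_law \<Delta> \<alpha> N) =
        (\<Sum>i = 1..N. \<Sum>j = 1..N. \<integral>S. ?W S i j \<partial>selection_law \<Delta> \<alpha> N)"
      by (intro has_bochner_integral_integral_eq has_bochner_integral_sum has_bochner_integral_integrable W)
    also have "1 / (real N)\<^sup>2 * \<dots> \<le> 1 / (real N)\<^sup>2 * (\<Sum>i = 1..N. \<Sum>j = 1..N. of_bool (i = j) + b)"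
      by (intro mult_left_mono sum_mono W) auto
    also have "(\<Sum>i = 1..N. \<Sum>j = 1..N. of_bool (i = j) + b) = real N + (real N)\<^sup>2 * b"
      by (simp add: sum.distrib of_bool_def power2_eq_square algebra_simps)
    also have "1 / (real N)\<^sup>2 * (real N + (real N)\<^sup>2 * b) = 1 / real N + b"
      using N by (simp add: power2_eq_square field_simps)
    finally show ?thesis .
  qed
  have mso: "mean_square_overlap \<pi> \<Delta> \<alpha> \<rho> N \<beta> t =
      (\<integral>x. ?g (fst x) (snd x) \<partial>(selection_law \<Delta> \<alpha> N \<Otimes>\<^sub>M bond_law \<Delta> N t))"
    unfolding mean_square_overlap_def disorder_law_def bond_law_def by (simp add: case_prod_beta')
  have "mean_square_overlap \<pi> \<Delta> \<alpha> \<rho> N \<beta> t \<le> 1 / real N + b"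
  proof (cases "integrable (selection_law \<Delta> \<alpha> N \<Otimes>\<^sub>M bond_law \<Delta> N t) (\<lambda>x. ?g (fst x) (snd x))")
    case True
    have "mean_square_overlap \<pi> \<Delta> \<alpha> \<rho> N \<beta> t = (\<integral>S. (\<integral>x. ?g S x \<partial>bond_law \<Delta> N t) \<partial>selection_law \<Delta> \<alpha> N)"
      unfolding mso using SB.integral_fst'[OF True] by simp
    also have "\<dots> \<le> (\<integral>S. ?G S \<partial>selection_law \<Delta> \<alpha> N)"
      using SB.integrable_fst'[OF True] by (intro integral_mono G inner) simp
    also note bound
    finally show ?thesis .
  next
    case False \<comment> \<open>the Bochner integral of a non-integrable function is \<open>0\<close>\<close>
    then show ?thesis
      unfolding mso using b0 by (simp add: not_integrable_integral_eq)
  qed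
  then show ?thesis by (simp add: b_def)
qed

theorem theorem1p5:
  fixes \<Delta> :: nat and \<alpha> :: "nat \<Rightarrow> real" and lam :: real
  assumes "\<Delta> \<ge> 2"
    and "\<And>p. p \<in> {2..\<Delta>} \<Longrightarrow> \<alpha> p > 0"
    and "lam = (\<Sum>p = 2..\<Delta>. real p * (real p - 1) * \<alpha> p)"
    and "lam > 1"
  shows "\<exists>C>0. \<forall>(\<rho> :: nat \<Rightarrow> real \<Rightarrow> real) (\<beta> :: ennreal) (t :: real) (N :: nat) (\<pi> :: perturbation).
           (\<forall>p\<in>{2..\<Delta>}. \<rho> p \<in> borel_measurable borel \<and> (\<forall>x. \<rho> p (- x) = - \<rho> p x)) \<longrightarrow>
           t \<ge> 0 \<longrightarrow> admissible_size \<Delta> \<alpha> N \<longrightarrow>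
           mean_square_overlap \<pi> \<Delta> \<alpha> \<rho> N \<beta> t \<le> C / real N powr (t / (t + 2 * ln lam))"
proof -
  \<comment> \<open>The first factor comes from Bernoulli's inequality, the second from a geometric
    sum, and the 2 bounds N / (N - 1). In the final constant 2 + \<open>A\<close>, the summand 2
    pays for the diagonal and for the noise term.\<close>
  define A where "A = real \<Delta> / (lam - 1) * (lam\<^sup>2 / (lam\<^sup>2 - 1)) * 2"
  have lam2: "1 < lam\<^sup>2" using assms(4) by (simp add: one_less_power)
  have A0: "0 \<le> A" using assms(4) lam2 by (simp add: A_def)
  have *: "mean_square_overlap \<pi> \<Delta> \<alpha> \<rho> N \<beta> t \<le> (2 + A) / real N powr (t / (t + 2 * ln lam))"
    if \<rho>: "\<forall>p\<in>{2..\<Delta>}. \<rho> p \<in> borel_measurable borel \<and> (\<forall>x. \<rho> p (- x) = - \<rho> p x)"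
      and t: "t \<ge> 0" and adm: "admissible_size \<Delta> \<alpha> N"
    for \<rho> :: "nat \<Rightarrow> real \<Rightarrow> real" and \<beta> t N \<pi>
  proof -
    have N: "2 \<le> N" using adm assms(1) by (simp add: admissible_size_def)
    have lnlam: "0 < ln lam" using assms(4) by simp
    define s where "s = t + 2 * ln lam"
    have s: "0 < s" using t lnlam by (simp add: s_def)
    define P where "P = real N powr (- (t / s))"
    have P: "0 < P" using N by (simp add: P_def)
    have rhs: "(2 + A) / real N powr (t / (t + 2 * ln lam)) = (2 + A) * P"
      by (simp add: P_def s_def powr_minus divide_inverse)
    show ?thesis
    \<comment> \<open>The noise estimate requires t > 0; at t = 0 the claimed rate is
      constant.\<close>
    proof (cases "t = 0")
      case True
      then have "P = 1" using N by (simp add: P_def)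
      then show ?thesis
        unfolding rhs using mean_square_overlap_le_1[of N \<pi> \<Delta> \<alpha> \<rho> \<beta> t] N A0 by simp
    next
      case False
      then have tpos: "0 < t" using t by simp
      \<comment> \<open>The real solution of exp(-t x) = lam^(2 x) / N; both sides then equal
        \<open>P\<close>.\<close>
      define x where "x = ln (real N) / s"
      have x0: "0 \<le> x" using N s by (simp add: x_def)
      \<comment> \<open>Rounding down suits the growth term, which needs K <= x. The decay term
        needs x <= K + 1, and its exponent is indeed \<open>Suc K\<close>.\<close>
      define K where "K = nat \<lfloor>x\<rfloor>"
      have K: "real K \<le> x" "x \<le> real (Suc K)"
        using x0 by (simp_all add: K_def) linarith
      have decay: "exp (- t) ^ Suc K \<le> P"
      proof -
        have "exp (- t) ^ Suc K = exp (- t * real (Suc K))"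
          by (simp only: exp_of_nat2_mult)
        also have "\<dots> \<le> exp (- t * x)"
          using K(2) tpos by simp
        also have "\<dots> = P"
          using N by (simp add: P_def powr_def x_def)
        finally show ?thesis .
      qed
      have invN: "1 / real N \<le> P"
      proof -
        have "1 / real N = real N powr (- 1)"
          using N by (simp add: powr_minus divide_inverse)
        also have "\<dots> \<le> P"
          unfolding P_def using N s lnlam tpos by (intro powr_mono) (auto simp: s_def divide_simps)
        finally show ?thesis .
      qed
      have growth: "(lam\<^sup>2) ^ K \<le> real N * P"
      proof -
        have "(lam\<^sup>2) ^ K = exp (2 * ln lam * real K)"
          using assms(4) exp_of_nat_mult[of "2 * K" "ln lam"] by (simp add: power_mult[symmetric] mult_ac)
        also have "\<dots> \<le> exp (2 * ln lam * x)"
          using K(1) lnlam by simp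
        also have "2 * ln lam * x = ln (real N) - t / s * ln (real N)"
          using s by (simp add: x_def s_def field_simps)
        also have "exp \<dots> = real N * P"
          using N by (simp add: exp_diff P_def powr_def exp_minus divide_inverse)
        finally show ?thesis .
      qed
      \<comment> \<open>Bernoulli's inequality trades the linear factor, the number of closing
        targets, for another power of lam. This makes the growth rate lam^2 and explains the 2 in
        front of ln lam in the exponent.\<close>
      have "(2 + real m * real \<Delta>) * lam ^ Suc m / (real N - 1) \<le>
          real \<Delta> / (lam - 1) / (real N - 1) * (lam\<^sup>2) ^ Suc m" for m
      proof -
        have "1 + real (Suc m) * (lam - 1) \<le> lam ^ Suc m"
          using Bernoulli_inequality[of "lam - 1" "Suc m"] assms(4) by simp
        then have "real (Suc m) \<le> lam ^ Suc m / (lam - 1)"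
          using assms(4) by (simp add: field_simps)
        then have "real \<Delta> * real (Suc m) \<le> real \<Delta> * (lam ^ Suc m / (lam - 1))"
          by (intro mult_left_mono) auto
        moreover have "2 + real m * real \<Delta> \<le> real \<Delta> * real (Suc m)"
          using assms(1) by (simp add: algebra_simps)
        ultimately have "2 + real m * real \<Delta> \<le> real \<Delta> * (lam ^ Suc m / (lam - 1))"
          by linarith
        then have "(2 + real m * real \<Delta>) * lam ^ Suc m / (real N - 1) \<le>
            real \<Delta> * (lam ^ Suc m / (lam - 1)) * lam ^ Suc m / (real N - 1)"
          using assms(4) N by (intro divide_right_mono mult_right_mono) auto
        then show ?thesis
          by (simp add: power2_eq_square power_mult_distrib mult_ac)
      qed
      then have "(\<Sum>m<K. (2 + real m * real \<Delta>) * lam ^ Suc m / (real N - 1)) \<le>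
          (\<Sum>m<K. real \<Delta> / (lam - 1) / (real N - 1) * (lam\<^sup>2) ^ Suc m)"
        by (intro sum_mono)
      also have "\<dots> = real \<Delta> / (lam - 1) / (real N - 1) * (lam\<^sup>2 * (\<Sum>m<K. (lam\<^sup>2) ^ m))"
        by (simp add: sum_distrib_left)
      also have "(\<Sum>m<K. (lam\<^sup>2) ^ m) = ((lam\<^sup>2) ^ K - 1) / (lam\<^sup>2 - 1)"
        using lam2 by (intro geometric_sum) simp
      also have "real \<Delta> / (lam - 1) / (real N - 1) * (lam\<^sup>2 * (((lam\<^sup>2) ^ K - 1) / (lam\<^sup>2 - 1))) \<le>
          real \<Delta> / (lam - 1) / (real N - 1) * (lam\<^sup>2 * ((real N * P) / (lam\<^sup>2 - 1)))"
        using growth lam2 assms(4) N by (intro mult_left_mono divide_right_mono) auto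
      also have "\<dots> = real \<Delta> / (lam - 1) * (lam\<^sup>2 / (lam\<^sup>2 - 1)) * (real N / (real N - 1)) * P"
        by (simp add: mult_ac)
      also have "\<dots> \<le> real \<Delta> / (lam - 1) * (lam\<^sup>2 / (lam\<^sup>2 - 1)) * 2 * P"
        using lam2 assms(4) N P by (intro mult_right_mono mult_left_mono) (auto simp: divide_simps)
      finally have walks: "(\<Sum>m<K. (2 + real m * real \<Delta>) * lam ^ Suc m / (real N - 1)) \<le> A * P"
        by (simp add: A_def)
      have "mean_square_overlap \<pi> \<Delta> \<alpha> \<rho> N \<beta> t \<le>
        1 / real N + exp (- t) ^ Suc K + (\<Sum>m<K. (2 + real m * real \<Delta>) * lam ^ Suc m / (real N - 1))"
        unfolding assms(3) by (rule mean_square_overlap_bound[OF assms(1,2) \<rho> tpos adm])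
      also have "\<dots> \<le> (2 + A) * P"
        using invN decay walks by (simp add: algebra_simps)
      finally show ?thesis unfolding rhs .
    qed
  qed
  show ?thesis
    using A0 * by (intro exI[of _ "2 + A"]) auto
qed

end
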